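(* Let $\nu\in\mathbb{N}_0$. For each $\theta\in\Theta^{\rm low}$, the spectral radius of the Fourier symbol $\widehat{\mathcal E}_i(\theta)$ of the two-level MGRIT error propagator is $$\rho\big(\widehat{\mathcal E}_i(\theta)\big)=|\lambda_i|^{m\nu}\,\frac{|\lambda_i^m-\mu_i|}{|e^{\mathrm i m\theta}-\mu_i|}.$$ Furthermore, the spectral radius of the (infinite-time-domain) error propagator $\mathcal E_i$ is $$\rho(\mathcal E_i)=\sup_{\theta\in\Theta^{\rm low}}\rho\big(\widehat{\mathcal E}_i(\theta)\big)=\rho\big(\widehat{\mathcal E}_i(\theta_i^\dagger)\big)=|\lambda_i|^{m\nu}\,\frac{|\lambda_i^m-\mu_i|}{1-|\mu_i|},$$ where $\theta_i^\dagger=\frac1m\arg\mu_i$ with $\arg\mu_i\in[-\pi,\pi)$ (any value if $\mu_i=0$).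
   Context: Let $m\in\mathbb{N}$ (coarsening factor), $\Theta^{\rm low}=[-\pi/m,\pi/m)$, and let $\lambda_i,\mu_i\in\mathbb{C}$ with $|\lambda_i|<1$, $|\mu_i|<1$ (the $i$th eigenvalues of the fine- and coarse-grid MGRIT time-stepping operators, which are assumed simultaneously unitarily diagonalizable). Let $\nu\in\mathbb{N}_0$ be the number of CF-relaxation sweeps in the pre-relaxation; $0^0=1$. Let $\mathbf 1\in\mathbb{R}^m$ be the column vector of ones. Error propagator. For $n_t$ time points ($m\mid n_t$), $$\mathcal E_i=S^{\rm F}_i\big(I_{n_t}-P_iA_{1,i}^{-1}P_i^\top A_{0,i}\big)(S^{\rm CF}_i)^\nu S^{\rm F}_i,$$ with $A_{0,i}=I_{n_t}-\lambda_iL_{n_t}$, $A_{1,i}=I_{n_t/m}-\mu_iL_{n_t/m}$, $P_i=I_{n_t/m}\otimes\mathbf e_1$, $S^{\rm F}_i=I_{n_t/m}\otimes[v(\lambda_i)\mathbf e_1^\top]$, $S^{\rm CF}_i=L_{n_t/m}\otimes[\lambda_iv(\lambda_i)\mathbf e_m^\top]$, where $L_n$ is the $n\times n$ lower shift matrix (ones on the first subdiagonal, zeros elsewhere), $v(\lambda)=(1,\lambda,\dots,\lambda^{m-1})^\top$, and $\mathbf e_1,\mathbf e_m\in\mathbb{R}^m$ are canonical basis vectors. In the local Fourier analysis (LFA) setting of the statement, $\mathcal E_i$ denotes the infinite-dimensional extension of this operator to an infinite time grid with boundary effects ignored (each $L_n$ replaced by the infinite-dimensional shift). Symbols. With $\boldsymbol\varphi_0(\theta)$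 the fine-grid Fourier mode with entries $e^{\mathrm i\theta k}$ at time points $t_k=k\,\delta t$, the harmonic space $\mathcal H^\theta_{\delta t}=\operatorname{span}_{0\le\alpha<m}\{\boldsymbol\varphi_0(\theta+2\pi\alpha/m)\}$ is invariant under $\mathcal E_i$ for $\theta\in\Theta^{\rm low}$, and $\mathcal E_i$ is represented there by its Fourier symbol $$\widehat{\mathcal E}_i(\theta)=\widehat S^{\rm F}_i(\theta)\Big(I_m-\widehat P_i(\theta)\big[\widehat A_{1,i}(m\theta)\big]^{-1}\widehat P_i^\top(\theta)\,\widehat A_{0,i}(\theta)\Big)\big(\widehat S^{\rm CF}_i(\theta)\big)^\nu\,\widehat S^{\rm F}_i(\theta)\in\mathbb{C}^{m\times m},$$ where $\widehat A_{0,i}(\theta)=\operatorname{diag}_{0\le\alpha<m}(1-\lambda_i e^{-\mathrm i(\theta+2\pi\alpha/m)})$, $\widehat A_{1,i}(m\theta)=1-\mu_i e^{-\mathrm i m\theta}$, $\widehat P_i(\theta)=\frac1{\sqrt m}\mathbf 1$, $\widehat S^{\rm F}_i(\theta)=c(\theta)[\widehat A_{0,i}(\theta)]^{-1}\mathbf 1\mathbf 1^\top$ with $c(\theta)=\frac1m[1-(\lambda_ie^{-\mathrm i\theta})^m]$, and $\widehat S^{\rm CF}_i(\theta)=\widehat S^{\rm F}_i(\theta)[I-\widehat A_{0,i}(\theta)]$. The operator $\mathcal E_i$ is (unitarily) block diagonalized as $\operatorname{diag}_{\theta\in\Theta^{\rm low}}(\widehat{\mathcal E}_i(\theta))$, and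 its spectral radius in LFA is, accordingly, $\rho(\mathcal E_i)=\sup_{\theta\in\Theta^{\rm low}}\rho(\widehat{\mathcal E}_i(\theta))$. *)

theory Defs
  imports
    "HOL-Analysis.Analysis"
    "Jordan_Normal_Form.Gauss_Jordan_Elimination"
    "Jordan_Normal_Form.Spectral_Radius"
begin

section \<open>Bounded operators on bi-infinite square-summable sequences\<close>

type_synonym cseq = "int \<Rightarrow> complex"

definition ell2 :: "cseq set" where
  "ell2 = {x. (\<lambda>k. (cmod (x k))\<^sup>2) summable_on UNIV}"

definition ell2_norm :: "cseq \<Rightarrow> real" where
  "ell2_norm x = sqrt (\<Sum>\<^sub>\<infinity>k. (cmod (x k))\<^sup>2)"

definition ell2_bounded_linear :: "(cseq \<Rightarrow> cseq) \<Rightarrow> bool" where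
  "ell2_bounded_linear T \<longleftrightarrow>
     (\<forall>x\<in>ell2. T x \<in> ell2) \<and>
     (\<forall>x\<in>ell2. \<forall>y\<in>ell2. T (\<lambda>k. x k + y k) = (\<lambda>k. T x k + T y k)) \<and>
     (\<forall>x\<in>ell2. \<forall>a. T (\<lambda>k. a * x k) = (\<lambda>k. a * T x k)) \<and>
     (\<exists>C. \<forall>x\<in>ell2. ell2_norm (T x) \<le> C * ell2_norm x)"

definition ell2_spectrum :: "(cseq \<Rightarrow> cseq) \<Rightarrow> complex set" where
  "ell2_spectrum T =
     {z. \<not> (\<exists>R. ell2_bounded_linear R \<and>
              (\<forall>x\<in>ell2. R (\<lambda>k. z * x k - T x k) = x \<and>
                        (\<lambda>k. z * R x k - T (R x) k) = x))}"

definition ell2_spectral_radius :: "(cseq \<Rightarrow> cseq) \<Rightarrow> real" where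
  "ell2_spectral_radius T = (SUP z\<in>ell2_spectrum T. cmod z)"


section \<open>The two-level error propagator on the infinite time grid\<close>

definition shift :: "cseq \<Rightarrow> cseq" where
  "shift x = (\<lambda>k. x (k - 1))"

text \<open>The Kronecker product of a sequence operator \<open>T\<close> with a finite matrix \<open>B\<close>: entry \<open>j\<close> of
  block \<open>K\<close> of a sequence with blocks of length \<open>n\<close> sits at index \<open>n * K + j\<close>. With
  \<open>dim_row B \<noteq> dim_col B\<close>, domain and range have different block lengths.\<close>

definition kron :: "(cseq \<Rightarrow> cseq) \<Rightarrow> complex Matrix.mat \<Rightarrow> cseq \<Rightarrow> cseq" where
  "kron T B x = (\<lambda>k.
     \<Sum>j<dim_col B. B $$ (nat (k mod int (dim_row B)), j) *
       T (\<lambda>K. x (int (dim_col B) * K + int j)) (k div int (dim_row B)))"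

definition vcol :: "nat \<Rightarrow> complex \<Rightarrow> complex Matrix.mat" where
  "vcol m lam = Matrix.mat m 1 (\<lambda>(i, j). lam ^ i)"

text \<open>Indices start at 0, so \<open>ecol m 0\<close> and \<open>ecol m (m - 1)\<close> are the first and the last
  canonical basis vector.\<close>

definition ecol :: "nat \<Rightarrow> nat \<Rightarrow> complex Matrix.mat" where
  "ecol m p = Matrix.mat m 1 (\<lambda>(i, j). if i = p then 1 else 0)"

text \<open>\<open>A_op lam\<close> is the fine-grid operator and \<open>A_op mu\<close> the coarse-grid one.\<close>

definition A_op :: "complex \<Rightarrow> cseq \<Rightarrow> cseq" where
  "A_op lam x = (\<lambda>k. x k - lam * shift x k)"

definition P_op :: "nat \<Rightarrow> cseq \<Rightarrow> cseq" where
  "P_op m = kron id (ecol m 0)"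

definition PT_op :: "nat \<Rightarrow> cseq \<Rightarrow> cseq" where
  "PT_op m = kron id (transpose_mat (ecol m 0))"

definition SF_op :: "nat \<Rightarrow> complex \<Rightarrow> cseq \<Rightarrow> cseq" where
  "SF_op m lam = kron id (vcol m lam * transpose_mat (ecol m 0))"

definition SCF_op :: "nat \<Rightarrow> complex \<Rightarrow> cseq \<Rightarrow> cseq" where
  "SCF_op m lam = kron shift (lam \<cdot>\<^sub>m (vcol m lam * transpose_mat (ecol m (m - 1))))"

definition coarse_correction :: "nat \<Rightarrow> complex \<Rightarrow> complex \<Rightarrow> cseq \<Rightarrow> cseq" where
  "coarse_correction m lam mu x =
     (\<lambda>k. x k - P_op m (the_inv_into ell2 (A_op mu) (PT_op m (A_op lam x))) k)"

definition E_op :: "nat \<Rightarrow> nat \<Rightarrow> complex \<Rightarrow> complex \<Rightarrow> cseq \<Rightarrow> cseq" where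
  "E_op m nu lam mu =
     SF_op m lam \<circ> coarse_correction m lam mu \<circ> (SCF_op m lam ^^ nu) \<circ> SF_op m lam"


section \<open>Its Fourier symbol\<close>

definition Theta_low :: "nat \<Rightarrow> real set" where
  "Theta_low m = {- pi / real m ..< pi / real m}"

definition A0_hat :: "nat \<Rightarrow> complex \<Rightarrow> real \<Rightarrow> complex Matrix.mat" where
  "A0_hat m lam \<theta> = mat_diag m (\<lambda>\<alpha>. 1 - lam * cis (- (\<theta> + 2 * pi * real \<alpha> / real m)))"

definition A1_hat :: "complex \<Rightarrow> real \<Rightarrow> complex" where
  "A1_hat mu \<omega> = 1 - mu * cis (- \<omega>)"

definition ones :: "nat \<Rightarrow> complex Matrix.mat" where
  "ones m = Matrix.mat m 1 (\<lambda>_. 1)"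

definition P_hat :: "nat \<Rightarrow> complex Matrix.mat" where
  "P_hat m = complex_of_real (1 / sqrt (real m)) \<cdot>\<^sub>m ones m"

definition SF_hat :: "nat \<Rightarrow> complex \<Rightarrow> real \<Rightarrow> complex Matrix.mat" where
  "SF_hat m lam \<theta> =
     (1 / of_nat m * (1 - (lam * cis (- \<theta>)) ^ m)) \<cdot>\<^sub>m
       (the (mat_inverse (A0_hat m lam \<theta>)) * (ones m * transpose_mat (ones m)))"

definition SCF_hat :: "nat \<Rightarrow> complex \<Rightarrow> real \<Rightarrow> complex Matrix.mat" where
  "SCF_hat m lam \<theta> = SF_hat m lam \<theta> * (1\<^sub>m m - A0_hat m lam \<theta>)"

definition E_hat :: "nat \<Rightarrow> nat \<Rightarrow> complex \<Rightarrow> complex \<Rightarrow> real \<Rightarrow> complex Matrix.mat" where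
  "E_hat m nu lam mu \<theta> =
     SF_hat m lam \<theta> *
     (1\<^sub>m m - P_hat m * (inverse (A1_hat mu (real m * \<theta>)) \<cdot>\<^sub>m transpose_mat (P_hat m)) *
        A0_hat m lam \<theta>) *
     (SCF_hat m lam \<theta> ^\<^sub>m nu) *
     SF_hat m lam \<theta>"

end

theory Submission
  imports Defs
begin

text \<open>
  Both spectra reduce to a scalar computation because ideal interpolation turns the two-level method
  into an operator on the C-points alone.

  For the operator, let \<open>V\<close> be ideal interpolation and \<open>R\<close> the restriction to C-points, so that
  \<open>R V = I\<close>. Then the error propagator is \<open>V G R\<close>, where
  \<open>G = \<lambda>^(m \<nu>) (\<lambda>^m - \<mu>) (I - \<mu> L)^-1 L^(\<nu> + 1)\<close> is a function of the coarse shift \<open>L\<close> (lemma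
  \<open>E_op_factor\<close>). Away from \<open>0\<close> the spectrum of \<open>V G R\<close> is that of \<open>G\<close>, the range of the symbol of \<open>G\<close> on the
  unit circle, whose largest modulus is \<open>\<bar>\<lambda>\<bar>^(m \<nu>) \<bar>\<lambda>^m - \<mu>\<bar> / (1 - \<bar>\<mu>\<bar>)\<close>. Two facts give
  the spectral radius. Beyond that modulus, \<open>z I - G\<close> becomes, after multiplication by \<open>(I - \<mu> L) / z\<close>, an operator
  \<open>I - \<mu> L - c L^(\<nu> + 1)\<close> with \<open>\<bar>\<mu>\<bar> + \<bar>c\<bar> < 1\<close>, which a convolution with absolutely
  summable coefficients inverts (\<open>ell2_spectrum_E_op_bound\<close>). Conversely, truncated
  exponentials are approximate eigenvectors, which puts every value of the symbol into the
  spectrum (\<open>coarse_symbol_in_ell2_spectrum_E_op\<close>).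

  For the Fourier symbol, F-relaxation is a projection of rank one, so the matrix is an outer product
  and its spectral radius is the modulus of its trace (\<open>E_hat_rank_one\<close>, \<open>spectral_radius_outer\<close>).

  The two results meet when the modulus of the trace is maximised over the frequencies: the
  denominator \<open>\<bar>cis (m \<theta>) - \<mu>\<bar>\<close> is at least \<open>1 - \<bar>\<mu>\<bar>\<close>, with equality where \<open>m \<theta>\<close> is an argument
  of \<open>\<mu>\<close>.
\<close>

section \<open>Bounded linear operators on square-summable sequences\<close>

lemma power_neq_one_if_norm_less_one:
  fixes x :: complex
  assumes "cmod x < 1" "n \<ge> 1"
  shows "x ^ n \<noteq> 1"
proof
  assume "x ^ n = 1"
  then have "cmod x ^ n = 1" by (metis norm_one norm_power)
  moreover have "cmod x ^ n < 1" using assms by (simp add: power_less_one_iff)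
  ultimately show False by simp
qed

text \<open>Estimates in \<open>ell2\<close> are reduced to the finite sections \<open>L2_set _ F\<close> of a sequence: the norm is their
  supremum, so a bound that is uniform in \<open>F\<close> gives membership and the norm bound at once, and the
  inequalities known for finite sums carry over.\<close>

lemma ell2_L2_set_le:
  assumes "x \<in> ell2" "finite F"
  shows "L2_set (\<lambda>k. cmod (x k)) F \<le> ell2_norm x"
  unfolding L2_set_def ell2_norm_def
  using assms by (intro real_sqrt_le_mono finite_sum_le_infsum) (auto simp: ell2_def)

lemma ell2_if_L2_set_le:
  assumes "\<And>F. finite F \<Longrightarrow> L2_set (\<lambda>k. cmod (x k)) F \<le> B"
  shows "x \<in> ell2" and "ell2_norm x \<le> B"
proof -
  have B: "B \<ge> 0" using assms[of "{}"] by simp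
  have *: "(\<Sum>k\<in>F. (cmod (x k))\<^sup>2) \<le> B\<^sup>2" if "finite F" for F
    using assms[OF that] by (simp add: L2_set_def sqrt_le_D)
  have s: "(\<lambda>k. (cmod (x k))\<^sup>2) summable_on UNIV"
    by (rule nonneg_bdd_above_summable_on) (use * in \<open>auto intro!: bdd_aboveI2\<close>)
  then show "x \<in> ell2" by (simp add: ell2_def)
  have "(\<Sum>\<^sub>\<infinity>k. (cmod (x k))\<^sup>2) \<le> B\<^sup>2"
    by (rule infsum_le_finite_sums[OF s]) (use * in auto)
  then show "ell2_norm x \<le> B"
    using B by (simp add: ell2_norm_def real_le_lsqrt infsum_nonneg)
qed

lemma ell2_norm_nonneg: "ell2_norm x \<ge> 0"
  by (simp add: ell2_norm_def infsum_nonneg)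

lemma cmod_le_ell2_norm: "x \<in> ell2 \<Longrightarrow> cmod (x k) \<le> ell2_norm x"
  using ell2_L2_set_le[of x "{k}"] by (simp add: L2_set_def)

lemma ell2_add:
  assumes "x \<in> ell2" "y \<in> ell2"
  shows "(\<lambda>k. x k + y k) \<in> ell2" "ell2_norm (\<lambda>k. x k + y k) \<le> ell2_norm x + ell2_norm y"
proof -
  have "L2_set (\<lambda>k. cmod (x k + y k)) F \<le> ell2_norm x + ell2_norm y" if "finite F" for F
  proof -
    have "L2_set (\<lambda>k. cmod (x k + y k)) F \<le> L2_set (\<lambda>k. cmod (x k) + cmod (y k)) F"
      by (rule L2_set_mono) (auto intro: norm_triangle_ineq)
    also have "\<dots> \<le> L2_set (\<lambda>k. cmod (x k)) F + L2_set (\<lambda>k. cmod (y k)) F"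
      by (rule L2_set_triangle_ineq)
    finally show ?thesis
      using ell2_L2_set_le[OF assms(1) that] ell2_L2_set_le[OF assms(2) that] by linarith
  qed
  from ell2_if_L2_set_le[OF this]
  show "(\<lambda>k. x k + y k) \<in> ell2" "ell2_norm (\<lambda>k. x k + y k) \<le> ell2_norm x + ell2_norm y" by auto
qed

lemma ell2_scale:
  assumes "x \<in> ell2"
  shows "(\<lambda>k. a * x k) \<in> ell2" "ell2_norm (\<lambda>k. a * x k) \<le> cmod a * ell2_norm x"
proof -
  have "L2_set (\<lambda>k. cmod (a * x k)) F \<le> cmod a * ell2_norm x" if "finite F" for F
    using ell2_L2_set_le[OF assms that]
    by (simp add: norm_mult flip: L2_set_right_distrib) (simp add: mult_left_mono)
  from ell2_if_L2_set_le[OF this]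
  show "(\<lambda>k. a * x k) \<in> ell2" "ell2_norm (\<lambda>k. a * x k) \<le> cmod a * ell2_norm x" by auto
qed

text \<open>Delays and the restriction to the coarse points both merely select entries of a sequence without
  repetition, hence are contractions.\<close>

lemma ell2_compose_inj:
  assumes "x \<in> ell2" "inj h"
  shows "(\<lambda>k. x (h k)) \<in> ell2" "ell2_norm (\<lambda>k. x (h k)) \<le> ell2_norm x"
proof -
  have "L2_set (\<lambda>k. cmod (x (h k))) F \<le> ell2_norm x" if "finite F" for F
  proof -
    have "L2_set (\<lambda>k. cmod (x (h k))) F = L2_set (\<lambda>k. cmod (x k)) (h ` F)"
      using assms(2) by (simp add: L2_set_def sum.reindex inj_on_def)
    then show ?thesis using ell2_L2_set_le[OF assms(1), of "h ` F"] that by simp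
  qed
  from ell2_if_L2_set_le[OF this]
  show "(\<lambda>k. x (h k)) \<in> ell2" "ell2_norm (\<lambda>k. x (h k)) \<le> ell2_norm x" by auto
qed

lemma ell2_bounded_linearI:
  assumes "\<And>x. x \<in> ell2 \<Longrightarrow> T x \<in> ell2"
    and "\<And>x. x \<in> ell2 \<Longrightarrow> ell2_norm (T x) \<le> C * ell2_norm x"
    and "\<And>x y. x \<in> ell2 \<Longrightarrow> y \<in> ell2 \<Longrightarrow> T (\<lambda>k. x k + y k) = (\<lambda>k. T x k + T y k)"
    and "\<And>x a. x \<in> ell2 \<Longrightarrow> T (\<lambda>k. a * x k) = (\<lambda>k. a * T x k)"
  shows "ell2_bounded_linear T"
  unfolding ell2_bounded_linear_def using assms by blast

lemma ell2_bounded_linearD: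
  assumes "ell2_bounded_linear T" "x \<in> ell2"
  shows "T x \<in> ell2"
    and "y \<in> ell2 \<Longrightarrow> T (\<lambda>k. x k + y k) = (\<lambda>k. T x k + T y k)"
    and "T (\<lambda>k. a * x k) = (\<lambda>k. a * T x k)"
  using assms by (auto simp: ell2_bounded_linear_def)

lemma ell2_bounded_linear_bound:
  assumes "ell2_bounded_linear T"
  obtains C where "C \<ge> 0" "\<And>x. x \<in> ell2 \<Longrightarrow> ell2_norm (T x) \<le> C * ell2_norm x"
proof -
  obtain C where C: "\<forall>x\<in>ell2. ell2_norm (T x) \<le> C * ell2_norm x"
    using assms by (auto simp: ell2_bounded_linear_def)
  have "ell2_norm (T x) \<le> \<bar>C\<bar> * ell2_norm x" if "x \<in> ell2" for x
    using bspec[OF C that] mult_right_mono[OF abs_ge_self[of C] ell2_norm_nonneg[of x]] by linarith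
  then show ?thesis using that[of "\<bar>C\<bar>"] by simp
qed

lemma ell2_diff:
  assumes "x \<in> ell2" "y \<in> ell2"
  shows "(\<lambda>k. x k - y k) \<in> ell2"
  using ell2_add(1)[OF assms(1) ell2_scale(1)[OF assms(2), of "-1"]] by simp

lemma ell2_bounded_linear_diff:
  assumes "ell2_bounded_linear T" "x \<in> ell2" "y \<in> ell2"
  shows "T (\<lambda>k. x k - y k) = (\<lambda>k. T x k - T y k)"
  using ell2_bounded_linearD(2)[OF assms(1,2) ell2_scale(1)[OF assms(3), of "-1"]]
    ell2_bounded_linearD(3)[OF assms(1,3), of "-1"] by simp

lemma ell2_bounded_linear_id: "ell2_bounded_linear (\<lambda>x. x)"
  by (rule ell2_bounded_linearI[where C = 1]) auto

lemma ell2_bounded_linear_comp: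
  assumes T: "ell2_bounded_linear T" and S: "ell2_bounded_linear S"
  shows "ell2_bounded_linear (\<lambda>x. T (S x))"
proof -
  obtain C D where CD: "C \<ge> 0" "\<And>x. x \<in> ell2 \<Longrightarrow> ell2_norm (T x) \<le> C * ell2_norm x"
      "D \<ge> 0" "\<And>x. x \<in> ell2 \<Longrightarrow> ell2_norm (S x) \<le> D * ell2_norm x"
    using ell2_bounded_linear_bound[OF T] ell2_bounded_linear_bound[OF S] by metis
  show ?thesis
  proof (rule ell2_bounded_linearI[where C = "C * D"])
    fix x assume x: "x \<in> ell2"
    note Sx = ell2_bounded_linearD[OF S x]
    show "T (S x) \<in> ell2" using ell2_bounded_linearD(1)[OF T Sx(1)] .
    have "ell2_norm (T (S x)) \<le> C * ell2_norm (S x)" using CD(2)[OF Sx(1)] .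
    also have "\<dots> \<le> C * (D * ell2_norm x)" using CD(1) CD(4)[OF x] by (rule mult_left_mono[rotated])
    finally show "ell2_norm (T (S x)) \<le> C * D * ell2_norm x" by (simp add: mult.assoc)
    show "T (S (\<lambda>k. a * x k)) = (\<lambda>k. a * T (S x) k)" for a
      using ell2_bounded_linearD(3)[OF T Sx(1)] Sx(3) by simp
    show "T (S (\<lambda>k. x k + y k)) = (\<lambda>k. T (S x) k + T (S y) k)" if "y \<in> ell2" for y
      using ell2_bounded_linearD(2)[OF T Sx(1) ell2_bounded_linearD(1)[OF S that]] Sx(2)[OF that] by simp
  qed
qed

lemma ell2_bounded_linear_add:
  assumes T: "ell2_bounded_linear T" and S: "ell2_bounded_linear S"
  shows "ell2_bounded_linear (\<lambda>x k. T x k + S x k)"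
proof -
  obtain C D where CD: "\<And>x. x \<in> ell2 \<Longrightarrow> ell2_norm (T x) \<le> C * ell2_norm x"
      "\<And>x. x \<in> ell2 \<Longrightarrow> ell2_norm (S x) \<le> D * ell2_norm x"
    using ell2_bounded_linear_bound[OF T] ell2_bounded_linear_bound[OF S] by metis
  show ?thesis
  proof (rule ell2_bounded_linearI[where C = "C + D"])
    fix x assume x: "x \<in> ell2"
    note Tx = ell2_bounded_linearD[OF T x] and Sx = ell2_bounded_linearD[OF S x]
    show "(\<lambda>k. T x k + S x k) \<in> ell2" by (rule ell2_add(1)[OF Tx(1) Sx(1)])
    show "ell2_norm (\<lambda>k. T x k + S x k) \<le> (C + D) * ell2_norm x"
      using ell2_add(2)[OF Tx(1) Sx(1)] CD(1)[OF x] CD(2)[OF x] by (simp add: algebra_simps)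
  qed (simp_all add: ell2_bounded_linearD[OF T] ell2_bounded_linearD[OF S] algebra_simps)
qed

lemma ell2_bounded_linear_scale:
  assumes T: "ell2_bounded_linear T"
  shows "ell2_bounded_linear (\<lambda>x k. a * T x k)"
proof -
  have "ell2_bounded_linear (\<lambda>x k. a * x k)"
    by (rule ell2_bounded_linearI[where C = "cmod a"]) (simp_all add: ell2_scale distrib_left mult.left_commute)
  from ell2_bounded_linear_comp[OF this T] show ?thesis .
qed

lemma ell2_bounded_linear_minus:
  assumes T: "ell2_bounded_linear T" and S: "ell2_bounded_linear S"
  shows "ell2_bounded_linear (\<lambda>x k. T x k - S x k)"
  using ell2_bounded_linear_add[OF T ell2_bounded_linear_scale[OF S, of "-1"]] by simp

lemma ell2_bounded_linear_reindex:
  assumes "inj h"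
  shows "ell2_bounded_linear (\<lambda>x k. x (h k))"
  by (rule ell2_bounded_linearI[where C = 1]) (use assms in \<open>simp_all add: ell2_compose_inj\<close>)

lemma inj_minus_const: "inj (\<lambda>k::int. k - n)"
  by (simp add: inj_def)

lemma ell2_delay: "x \<in> ell2 \<Longrightarrow> (\<lambda>k. x (k - n)) \<in> ell2"
  by (rule ell2_compose_inj(1)[OF _ inj_minus_const])

section \<open>Convolution operators and inverses of sparse polynomials in the shift\<close>

text \<open>The power series coefficients of \<open>1 / (1 - b X - c X^(q + 1))\<close>. This one family serves two
  purposes: with \<open>c = 0\<close> it inverts the coarse-grid operator \<open>I - \<mu> L\<close>, and with general \<open>c\<close> it
  gives the resolvent of the error propagator.\<close>

fun recip_coeff :: "complex \<Rightarrow> complex \<Rightarrow> nat \<Rightarrow> nat \<Rightarrow> complex" where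
  "recip_coeff b c q 0 = 1"
| "recip_coeff b c q (Suc n) =
     b * recip_coeff b c q n + (if q \<le> n then c * recip_coeff b c q (n - q) else 0)"

text \<open>The partial sums \<open>s\<close> of the absolute values obey \<open>s (N + 1) \<le> 1 + r s N\<close> with \<open>r = \<bar>b\<bar> + \<bar>c\<bar> < 1\<close>,
  so they stay below the fixed point \<open>1 / (1 - r)\<close>.\<close>

lemma summable_norm_recip_coeff:
  assumes "cmod b + cmod c < 1"
  shows "summable (\<lambda>n. cmod (recip_coeff b c q n))"
proof -
  define s where "s = (\<lambda>N. \<Sum>n<N. cmod (recip_coeff b c q n))"
  define r where "r = cmod b + cmod c"
  have s_nn: "s N \<ge> 0" for N by (simp add: s_def sum_nonneg)
  have step: "s (Suc N) \<le> 1 + r * s N" for N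
  proof -
    have "(\<Sum>n<N. cmod (if q \<le> n then recip_coeff b c q (n - q) else 0)) =
          (\<Sum>n\<in>{q..<N}. cmod (recip_coeff b c q (n - q)))"
      by (rule sum.mono_neutral_cong_right) auto
    also have "\<dots> = (\<Sum>n\<in>(\<lambda>n. n - q) ` {q..<N}. cmod (recip_coeff b c q n))"
      by (subst sum.reindex) (auto simp: inj_on_def)
    also have "\<dots> \<le> s N"
      unfolding s_def by (rule sum_mono2) auto
    finally have A: "(\<Sum>n<N. cmod (if q \<le> n then recip_coeff b c q (n - q) else 0)) \<le> s N" .
    have "s (Suc N) = 1 + (\<Sum>n<N. cmod (recip_coeff b c q (Suc n)))"
      unfolding s_def by (subst sum.lessThan_Suc_shift) simp
    also have "(\<Sum>n<N. cmod (recip_coeff b c q (Suc n))) \<le>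
        (\<Sum>n<N. cmod b * cmod (recip_coeff b c q n) +
               cmod c * cmod (if q \<le> n then recip_coeff b c q (n - q) else 0))"
      by (rule sum_mono) (auto simp: norm_mult intro: order_trans[OF norm_triangle_ineq])
    also have "\<dots> = cmod b * s N + cmod c * (\<Sum>n<N. cmod (if q \<le> n then recip_coeff b c q (n - q) else 0))"
      by (simp add: s_def sum.distrib sum_distrib_left)
    also have "\<dots> \<le> cmod b * s N + cmod c * s N"
      using A by (simp add: mult_left_mono)
    finally show ?thesis by (simp add: r_def algebra_simps)
  qed
  have r: "0 \<le> r" "r < 1" using assms by (auto simp: r_def)
  have "s N \<le> 1 / (1 - r)" for N
  proof (induction N)
    case 0 then show ?case using r by (simp add: s_def)
  next
    case (Suc N)
    have "s (Suc N) \<le> 1 + r * (1 / (1 - r))"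
      using step[of N] mult_left_mono[OF Suc r(1)] by linarith
    also have "\<dots> = 1 / (1 - r)" using r by (simp add: field_simps)
    finally show ?case .
  qed
  then show ?thesis
    by (intro summableI_nonneg_bounded[where x = "1 / (1 - r)"]) (auto simp: s_def)
qed

definition conv :: "(nat \<Rightarrow> complex) \<Rightarrow> cseq \<Rightarrow> cseq" where
  "conv a x = (\<lambda>k. \<Sum>n. a n * x (k - int n))"

lemma conv_summable:
  assumes "summable (\<lambda>n. cmod (a n))" "x \<in> ell2"
  shows "summable (\<lambda>n. a n * x (k - int n))"
proof (rule summable_comparison_test'[where N = 0])
  show "summable (\<lambda>n. cmod (a n) * ell2_norm x)" using assms(1) by (rule summable_mult2)
  show "norm (a n * x (k - int n)) \<le> cmod (a n) * ell2_norm x" for n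
    using cmod_le_ell2_norm[OF assms(2)] by (simp add: norm_mult mult_left_mono)
qed

lemma conv_delay: "conv a (\<lambda>k. x (k - n)) = (\<lambda>k. conv a x (k - n))"
  by (simp add: conv_def algebra_simps)

text \<open>Young's inequality for an absolutely summable kernel: partial sums are combinations of delayed
  copies of \<open>x\<close>, bounded by the triangle inequality, and on a finite section the pointwise
  convergence suffices to pass to the limit.\<close>

lemma ell2_bounded_linear_conv:
  assumes a: "summable (\<lambda>n. cmod (a n))"
  shows "ell2_bounded_linear (conv a)"
proof -
  have L2: "L2_set (\<lambda>k. cmod (conv a x k)) F \<le> (\<Sum>n. cmod (a n)) * ell2_norm x"
    if x: "x \<in> ell2" and F: "finite F" for x F
  proof (rule tendsto_upperbound)
    define p where "p = (\<lambda>N k. \<Sum>n<N. a n * x (k - int n))"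
    have p: "p N \<in> ell2 \<and> ell2_norm (p N) \<le> (\<Sum>n<N. cmod (a n)) * ell2_norm x" for N
    proof (induction N)
      case 0 
      have "ell2_norm (\<lambda>k. 0 * x k) \<le> 0" using ell2_scale(2)[OF x, of 0] by simp
      then show ?case using ell2_scale(1)[OF x, of 0] by (simp add: p_def)
    next
      case (Suc N)
      define y where "y = (\<lambda>k. x (k - int N))"
      have y: "y \<in> ell2" "ell2_norm y \<le> ell2_norm x"
        using ell2_compose_inj[OF x inj_minus_const] by (simp_all add: y_def)
      have "p (Suc N) = (\<lambda>k. p N k + a N * y k)" by (simp add: p_def y_def)
      moreover have "ell2_norm (\<lambda>k. a N * y k) \<le> cmod (a N) * ell2_norm x"
        using ell2_scale(2)[OF y(1), of "a N"] mult_left_mono[OF y(2), of "cmod (a N)"] by simp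
      ultimately show ?case
        using ell2_add[of "p N" "\<lambda>k. a N * y k"] ell2_scale(1)[OF y(1), of "a N"] Suc
        by (auto simp: algebra_simps)
    qed
    have "(\<lambda>N. p N k) \<longlonglongrightarrow> conv a x k" for k
      unfolding p_def conv_def using summable_LIMSEQ[OF conv_summable[OF a x]] .
    then show "(\<lambda>N. L2_set (\<lambda>k. cmod (p N k)) F) \<longlonglongrightarrow> L2_set (\<lambda>k. cmod (conv a x k)) F"
      unfolding L2_set_def by (intro tendsto_intros)
    have "L2_set (\<lambda>k. cmod (p N k)) F \<le> (\<Sum>n. cmod (a n)) * ell2_norm x" for N
    proof -
      have "L2_set (\<lambda>k. cmod (p N k)) F \<le> (\<Sum>n<N. cmod (a n)) * ell2_norm x"
        using p[of N] ell2_L2_set_le[OF _ F, of "p N"] by linarith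
      also have "\<dots> \<le> (\<Sum>n. cmod (a n)) * ell2_norm x"
        by (intro mult_right_mono sum_le_suminf a ell2_norm_nonneg) auto
      finally show ?thesis .
    qed
    then show "\<forall>\<^sub>F N in sequentially. L2_set (\<lambda>k. cmod (p N k)) F \<le> (\<Sum>n. cmod (a n)) * ell2_norm x"
      by simp
  qed simp
  show ?thesis
  proof (rule ell2_bounded_linearI[where C = "\<Sum>n. cmod (a n)"])
    fix x assume x: "x \<in> ell2"
    show "conv a x \<in> ell2" "ell2_norm (conv a x) \<le> (\<Sum>n. cmod (a n)) * ell2_norm x"
      using ell2_if_L2_set_le[OF L2[OF x]] by auto
    show "conv a (\<lambda>k. b * x k) = (\<lambda>k. b * conv a x k)" for b
      using suminf_mult[OF conv_summable[OF a x], of b] by (simp add: conv_def algebra_simps)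
    show "conv a (\<lambda>k. x k + y k) = (\<lambda>k. conv a x k + conv a y k)" if "y \<in> ell2" for y
      using suminf_add[OF conv_summable[OF a x] conv_summable[OF a that]]
      by (simp add: conv_def algebra_simps)
  qed
qed

text \<open>Writing each delayed copy of \<open>y\<close> as a series in the same entries \<open>x (k - n)\<close>, the recursion for the
  coefficients cancels every term except the one with \<open>n = 0\<close>.\<close>

lemma conv_recip_coeff_right_inverse:
  fixes b c :: complex and q :: nat and x :: cseq
  assumes bc: "cmod b + cmod c < 1" and x: "x \<in> ell2"
  defines "y \<equiv> conv (recip_coeff b c q) x"
  shows "y k - b * y (k - 1) - c * y (k - int (Suc q)) = x k"
proof -
  let ?a = "recip_coeff b c q"
  have y: "(\<lambda>n. ?a n * x (k - int n)) sums y k" for k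
    unfolding y_def conv_def
    by (rule summable_sums[OF conv_summable[OF summable_norm_recip_coeff[OF bc] x]])
  have delayed: "(\<lambda>n. if n < p then 0 else ?a (n - p) * x (k - int n)) sums y (k - int p)" for p
    by (rule sums_zero_iff_shift[THEN iffD1, where n1 = p]) (use y[of "k - int p"] in \<open>auto simp: algebra_simps\<close>)
  have "(\<lambda>n. ?a n * x (k - int n) - b * (if n < 1 then 0 else ?a (n - 1) * x (k - int n))
          - c * (if n < Suc q then 0 else ?a (n - Suc q) * x (k - int n)))
        sums (y k - b * y (k - int 1) - c * y (k - int (Suc q)))"
    by (intro sums_diff sums_mult y delayed)
  moreover have "?a n * x (k - int n) - b * (if n < 1 then 0 else ?a (n - 1) * x (k - int n))
          - c * (if n < Suc q then 0 else ?a (n - Suc q) * x (k - int n)) = (if n = 0 then x k else 0)" for n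
    by (cases n) (auto simp: algebra_simps)
  ultimately have "(\<lambda>n. if n = 0 then x k else 0) sums (y k - b * y (k - 1) - c * y (k - int (Suc q)))"
    by simp
  moreover have "(\<lambda>n::nat. if n = 0 then x k else 0) sums x k"
    using sums_single[of 0 "\<lambda>_. x k"] by simp
  ultimately show ?thesis by (metis sums_unique2)
qed

text \<open>Convolutions commute with delays, so the right inverse is also a left inverse.\<close>

lemma conv_recip_coeff_left_inverse:
  assumes bc: "cmod b + cmod c < 1" and x: "x \<in> ell2"
  shows "conv (recip_coeff b c q) (\<lambda>k. x k - b * x (k - 1) - c * x (k - int (Suc q))) = x"
proof -
  note T = ell2_bounded_linear_conv[OF summable_norm_recip_coeff[OF bc, of q]]
  note d = ell2_delay[OF x]
  have "conv (recip_coeff b c q) (\<lambda>k. x k - b * x (k - 1) - c * x (k - int (Suc q))) =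
    (\<lambda>k. conv (recip_coeff b c q) x k - b * conv (recip_coeff b c q) x (k - 1)
         - c * conv (recip_coeff b c q) x (k - int (Suc q)))"
    by (subst ell2_bounded_linear_diff[OF T ell2_diff[OF x ell2_scale(1)[OF d]] ell2_scale(1)[OF d]],
        subst ell2_bounded_linear_diff[OF T x ell2_scale(1)[OF d]])
       (simp only: ell2_bounded_linearD(3)[OF T d] conv_delay)
  then show ?thesis using conv_recip_coeff_right_inverse[OF bc x, of q] by (simp add: fun_eq_iff)
qed

section \<open>Reduction of the error propagator to the coarse points\<close>

lemma block_index:
  fixes m :: nat and K r :: int
  assumes "0 \<le> r" "r < int m"
  shows "(int m * K + r) div int m = K" "(int m * K + r) mod int m = r"
  using assms by (auto intro: int_div_pos_eq int_mod_pos_eq)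

text \<open>Ideal interpolation, which extends coarse values to the F-points by the fine-grid recursion, and
  the restriction to the C-points, one of its left inverses.\<close>

definition prolong :: "nat \<Rightarrow> complex \<Rightarrow> cseq \<Rightarrow> cseq" where
  "prolong m lam c = (\<lambda>k. lam ^ nat (k mod int m) * c (k div int m))"

definition c_points :: "nat \<Rightarrow> cseq \<Rightarrow> cseq" where
  "c_points m x = (\<lambda>K. x (int m * K))"

lemma c_points_prolong:
  assumes "m \<ge> 1"
  shows "c_points m (prolong m lam c) = c"
  using assms by (simp add: c_points_def prolong_def)

lemma prolong_diff: "prolong m lam (\<lambda>k. x k - y k) = (\<lambda>k. prolong m lam x k - prolong m lam y k)"
  and prolong_scale: "prolong m lam (\<lambda>k. a * x k) = (\<lambda>k. a * prolong m lam x k)"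
  and prolong_add: "prolong m lam (\<lambda>k. x k + y k) = (\<lambda>k. prolong m lam x k + prolong m lam y k)"
  by (simp_all add: prolong_def algebra_simps)

lemma ell2_bounded_linear_c_points:
  assumes "m \<ge> 1"
  shows "ell2_bounded_linear (c_points m)"
  unfolding c_points_def [abs_def] using assms
  by (intro ell2_bounded_linear_reindex) (simp add: inj_def)

lemma ell2_norm_c_points_le:
  assumes "m \<ge> 1" "x \<in> ell2"
  shows "ell2_norm (c_points m x) \<le> ell2_norm x"
  unfolding c_points_def using assms
  by (intro ell2_compose_inj(2)) (auto simp: inj_def)

text \<open>Each coarse value is copied to the \<open>m\<close> entries of its block with a weight of modulus at most one,
  so the squared norm grows by a factor of at most \<open>m\<close>.\<close>

lemma ell2_bounded_linear_prolong:
  assumes m: "m \<ge> 1" and lam: "cmod lam < 1"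
  shows "ell2_bounded_linear (prolong m lam)"
proof -
  have "L2_set (\<lambda>k. cmod (prolong m lam c k)) F \<le> sqrt (real m) * ell2_norm c"
    if c: "c \<in> ell2" and F: "finite F" for c F
  proof -
    define D where "D = (\<lambda>k. k div int m) ` F"
    define h where "h = (\<lambda>k. (k div int m, k mod int m))"
    have "(\<Sum>k\<in>F. (cmod (prolong m lam c k))\<^sup>2) \<le> (\<Sum>k\<in>F. (cmod (c (k div int m)))\<^sup>2)"
    proof (intro sum_mono power_mono)
      fix k
      have "cmod lam ^ nat (k mod int m) \<le> 1" using lam by (simp add: power_le_one)
      then show "cmod (prolong m lam c k) \<le> cmod (c (k div int m))"
        by (simp add: prolong_def norm_mult norm_power mult_left_le_one_le)
    qed simp
    also have "\<dots> = (\<Sum>p\<in>h ` F. (cmod (c (fst p)))\<^sup>2)"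
    proof -
      have "inj h"
      proof (rule injI)
        fix x y assume "h x = h y"
        then have "x div int m = y div int m" "x mod int m = y mod int m"
          by (simp_all add: h_def)
        then show "x = y" by (metis div_mult_mod_eq)
      qed
      then have "inj_on h F" by (rule inj_on_subset) simp
      then show ?thesis
        using sum.reindex[of h F "\<lambda>p. (cmod (c (fst p)))\<^sup>2"] by (simp add: h_def)
    qed
    also have "\<dots> \<le> (\<Sum>p\<in>D \<times> {0..<int m}. (cmod (c (fst p)))\<^sup>2)"
      using F m by (intro sum_mono2) (auto simp: h_def D_def)
    also have "\<dots> = (\<Sum>K\<in>D. \<Sum>j\<in>{0..<int m}. (cmod (c K))\<^sup>2)"
      by (simp add: sum.cartesian_product case_prod_beta del: sum_constant)
    also have "\<dots> = real m * (\<Sum>K\<in>D. (cmod (c K))\<^sup>2)" by (simp add: sum_distrib_left)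
    finally have "L2_set (\<lambda>k. cmod (prolong m lam c k)) F \<le> sqrt (real m) * L2_set (\<lambda>k. cmod (c k)) D"
      by (simp add: L2_set_def flip: real_sqrt_mult)
    also have "\<dots> \<le> sqrt (real m) * ell2_norm c"
      using F by (intro mult_left_mono ell2_L2_set_le c) (auto simp: D_def)
    finally show ?thesis .
  qed
  note * = ell2_if_L2_set_le[OF this]
  show ?thesis
    by (rule ell2_bounded_linearI[where C = "sqrt (real m)"])
       (simp_all add: * prolong_scale prolong_add)
qed

text \<open>The error propagator as seen from the C-points,
  \<open>\<lambda>^(m \<nu>) (\<lambda>^m - \<mu>) (I - \<mu> L)^-1 L^(\<nu> + 1)\<close>. The choice \<open>c = 0\<close>, \<open>q = 0\<close> below reduces the
  coefficients to the powers of \<open>\<mu>\<close>.\<close>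

definition coarse_propagator :: "nat \<Rightarrow> nat \<Rightarrow> complex \<Rightarrow> complex \<Rightarrow> cseq \<Rightarrow> cseq" where
  "coarse_propagator m nu lam mu c = conv (recip_coeff mu 0 0)
     (\<lambda>K. lam ^ (m * nu) * (lam ^ m - mu) * c (K - int (Suc nu)))"

lemma ell2_bounded_linear_coarse_propagator:
  assumes "cmod mu < 1"
  shows "ell2_bounded_linear (coarse_propagator m nu lam mu)"
  unfolding coarse_propagator_def
  by (intro ell2_bounded_linear_comp[OF ell2_bounded_linear_conv[OF summable_norm_recip_coeff]]
      ell2_bounded_linear_scale ell2_bounded_linear_reindex inj_minus_const) (use assms in simp)

text \<open>The operator \<open>A_op mu\<close> has a two-sided inverse on \<open>ell2\<close>, so the coarse solve inside the error
  propagator is a genuine solve.\<close>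

lemma coarse_solve:
  assumes mu: "cmod mu < 1" and y: "y \<in> ell2"
  shows "the_inv_into ell2 (A_op mu) y = conv (recip_coeff mu 0 0) y"
proof -
  have mu0: "cmod mu + cmod 0 < 1" using mu by simp
  have A: "A_op mu x = (\<lambda>k. x k - mu * x (k - 1) - 0 * x (k - int (Suc 0)))" for x
    by (simp add: A_op_def shift_def)
  have left: "conv (recip_coeff mu 0 0) (A_op mu x) = x" if "x \<in> ell2" for x
    unfolding A by (rule conv_recip_coeff_left_inverse[OF mu0 that])
  have right: "A_op mu (conv (recip_coeff mu 0 0) y) = y"
    unfolding A using conv_recip_coeff_right_inverse[OF mu0 y, of 0] by (simp add: fun_eq_iff)
  have "inj_on (A_op mu) ell2" by (rule inj_on_inverseI[where g = "conv (recip_coeff mu 0 0)"]) (rule left)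
  then show ?thesis
    using ell2_bounded_linearD(1)[OF ell2_bounded_linear_conv[OF summable_norm_recip_coeff[OF mu0]] y]
    by (intro the_inv_into_f_eq) (simp_all add: right)
qed

lemma SF_op_eq:
  assumes "m \<ge> 1"
  shows "SF_op m lam x = prolong m lam (c_points m x)"
proof
  fix k
  have "nat (k mod int m) < m" using assms by (simp add: nat_less_iff)
  then have "SF_op m lam x k =
      (\<Sum>j<m. lam ^ nat (k mod int m) * (if j = 0 then 1 else 0) * x (int m * (k div int m) + int j))"
    by (auto simp: SF_op_def kron_def vcol_def ecol_def scalar_prod_def intro!: sum.cong)
  also have "\<dots> = (\<Sum>j\<in>{0}. lam ^ nat (k mod int m) * x (int m * (k div int m) + int j))"
    using assms by (intro sum.mono_neutral_cong_right) auto
  finally show "SF_op m lam x k = prolong m lam (c_points m x) k"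
    by (simp add: prolong_def c_points_def)
qed

text \<open>On interpolated sequences a CF-relaxation sweep is one step of the exact coarse-grid time
  stepping: the last entry of the previous block already carries \<open>\<lambda>^(m - 1)\<close>, and the C-relaxation adds one more
  factor.\<close>

lemma SCF_op_prolong:
  assumes "m \<ge> 1"
  shows "SCF_op m lam (prolong m lam c) = prolong m lam (\<lambda>K. lam ^ m * c (K - 1))"
proof
  fix k
  have "nat (k mod int m) < m" using assms by (simp add: nat_less_iff)
  then have "SCF_op m lam (prolong m lam c) k =
      (\<Sum>j<m. lam * (lam ^ nat (k mod int m) * (if j = m - 1 then 1 else 0)) *
         prolong m lam c (int m * (k div int m - 1) + int j))"
    using assms
    by (auto simp: SCF_op_def kron_def vcol_def ecol_def scalar_prod_def shift_def intro!: sum.cong)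
  also have "\<dots> = (\<Sum>j\<in>{m - 1}. lam * lam ^ nat (k mod int m) *
         prolong m lam c (int m * (k div int m - 1) + int j))"
    using assms by (intro sum.mono_neutral_cong_right) auto
  also have "\<dots> = lam * lam ^ nat (k mod int m) *
      prolong m lam c (int m * (k div int m - 1) + int (m - 1))" by simp
  also have "prolong m lam c (int m * (k div int m - 1) + int (m - 1)) = lam ^ (m - 1) * c (k div int m - 1)"
  proof -
    have "(int m * (k div int m - 1) + int (m - 1)) div int m = k div int m - 1"
      using assms by (intro block_index) auto
    moreover have "(int m * (k div int m - 1) + int (m - 1)) mod int m = int (m - 1)"
      using assms by (intro block_index) auto
    ultimately show ?thesis by (simp add: prolong_def)
  qed
  finally have "SCF_op m lam (prolong m lam c) k =
      lam ^ nat (k mod int m) * ((lam * lam ^ (m - 1)) * c (k div int m - 1))"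
    by (simp add: algebra_simps)
  also have "lam * lam ^ (m - 1) = lam ^ m" using assms by (cases m) auto
  finally show "SCF_op m lam (prolong m lam c) k = prolong m lam (\<lambda>K. lam ^ m * c (K - 1)) k"
    by (simp add: prolong_def)
qed

lemma SCF_op_pow_prolong:
  assumes "m \<ge> 1"
  shows "(SCF_op m lam ^^ n) (prolong m lam c) = prolong m lam (\<lambda>K. lam ^ (m * n) * c (K - int n))"
proof (induction n)
  case (Suc n)
  show ?case
    by (simp add: Suc SCF_op_prolong[OF assms] power_add mult.assoc diff_diff_add add.commute)
qed simp

lemma PT_op_eq:
  assumes "m \<ge> 1"
  shows "PT_op m x = c_points m x"
proof
  fix k
  have "PT_op m x k = (\<Sum>j<m. (if j = 0 then 1 else 0) * x (int m * k + int j))"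
    by (auto simp: PT_op_def kron_def ecol_def intro!: sum.cong)
  also have "\<dots> = (\<Sum>j\<in>{0}. x (int m * k + int j))"
    using assms by (intro sum.mono_neutral_cong_right) auto
  finally show "PT_op m x k = c_points m x k" by (simp add: c_points_def)
qed

lemma c_points_P_op:
  assumes "m \<ge> 1"
  shows "c_points m (P_op m w) = w"
  using assms by (simp add: c_points_def P_op_def kron_def ecol_def fun_eq_iff)

text \<open>The fine residual of an interpolated sequence, restricted to the C-points, is the residual for the
  exact (Schur complement) coarse operator \<open>I - \<lambda>^m L\<close>.\<close>

lemma c_points_A_op_prolong:
  assumes "m \<ge> 1"
  shows "c_points m (A_op lam (prolong m lam c)) = (\<lambda>K. c K - lam ^ m * c (K - 1))"
proof
  fix K
  have "(int m * K - 1) div int m = K - 1" "(int m * K - 1) mod int m = int (m - 1)"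
  proof -
    have e: "int m * K - 1 = int m * (K - 1) + int (m - 1)"
      using assms by (simp add: algebra_simps)
    show "(int m * K - 1) div int m = K - 1" unfolding e
      using assms by (intro block_index) auto
    show "(int m * K - 1) mod int m = int (m - 1)" unfolding e
      using assms by (intro block_index) auto
  qed
  moreover have "nat (int m - 1) = m - 1" by simp
  moreover have "lam * lam ^ (m - 1) = lam ^ m" using assms by (cases m) auto
  ultimately show "c_points m (A_op lam (prolong m lam c)) K = c K - lam ^ m * c (K - 1)"
    using assms by (simp add: c_points_def A_op_def shift_def prolong_def flip: mult.assoc)
qed

text \<open>All that happens between the two F-relaxations takes place on interpolated sequences, so the error
  propagator is determined by its action on C-points. There the coarse-grid correction is
  \<open>I - (I - \<mu> L)^-1 (I - \<lambda>^m L) = (\<lambda>^m - \<mu>) (I - \<mu> L)^-1 L\<close>, and the \<open>\<nu>\<close> sweeps before it contribute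
  \<open>\<lambda>^(m \<nu>) L^\<nu>\<close>.\<close>

lemma E_op_factor:
  assumes m: "m \<ge> 1" and mu: "cmod mu < 1" and x: "x \<in> ell2"
  shows "E_op m nu lam mu x = prolong m lam (coarse_propagator m nu lam mu (c_points m x))"
proof -
  have mu0: "cmod mu + cmod 0 < 1" using mu by simp
  define u where "u = c_points m x"
  define c where "c = (\<lambda>K. lam ^ (m * nu) * u (K - int nu))"
  define y where "y = prolong m lam c"
  have u: "u \<in> ell2" unfolding u_def by (rule ell2_bounded_linearD(1)[OF ell2_bounded_linear_c_points[OF m] x])
  have c: "c \<in> ell2" unfolding c_def by (intro ell2_scale ell2_delay u)
  have c1: "(\<lambda>K. c (K - 1)) \<in> ell2" by (rule ell2_delay[OF c])
  note bl = ell2_bounded_linear_conv[OF summable_norm_recip_coeff[OF mu0], of 0]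
  define r where "r = (\<lambda>K. c K - lam ^ m * c (K - 1))"
  have r: "r \<in> ell2" unfolding r_def by (intro ell2_diff ell2_scale c c1)
  have c_eq: "c = conv (recip_coeff mu 0 0) (\<lambda>K. c K - mu * c (K - 1))"
    using conv_recip_coeff_left_inverse[OF mu0 c, of 0] by simp
  have "(SCF_op m lam ^^ nu) (SF_op m lam x) = y"
    by (simp add: SF_op_eq[OF m] SCF_op_pow_prolong[OF m] y_def c_def u_def)
  moreover have "SF_op m lam (coarse_correction m lam mu y) =
      prolong m lam (\<lambda>K. c K - conv (recip_coeff mu 0 0) r K)"
  proof -
    have PTA: "PT_op m (A_op lam y) = r"
      by (simp add: PT_op_eq[OF m] y_def c_points_A_op_prolong[OF m] r_def)
    have "c_points m (coarse_correction m lam mu y) = (\<lambda>K. c K - conv (recip_coeff mu 0 0) r K)"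
      unfolding coarse_correction_def PTA coarse_solve[OF mu r]
      using c_points_prolong[OF m, of lam c] c_points_P_op[OF m]
      by (simp add: c_points_def y_def fun_eq_iff)
    then show ?thesis by (simp add: SF_op_eq[OF m])
  qed
  moreover have "(\<lambda>K. c K - conv (recip_coeff mu 0 0) r K) = coarse_propagator m nu lam mu u"
  proof -
    have d: "(\<lambda>K. c K - mu * c (K - 1)) \<in> ell2" by (intro ell2_diff ell2_scale c c1)
    have "(\<lambda>K. c K - conv (recip_coeff mu 0 0) r K) =
        conv (recip_coeff mu 0 0) (\<lambda>K. (c K - mu * c (K - 1)) - r K)"
      unfolding ell2_bounded_linear_diff[OF bl d r] c_eq[symmetric] ..
    also have "(\<lambda>K. (c K - mu * c (K - 1)) - r K) =
        (\<lambda>K. lam ^ (m * nu) * (lam ^ m - mu) * u (K - int (Suc nu)))"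
      by (simp add: r_def c_def fun_eq_iff algebra_simps)
    finally show ?thesis by (simp add: coarse_propagator_def)
  qed
  ultimately show ?thesis by (simp add: E_op_def u_def)
qed

section \<open>Spectrum of the error propagator\<close>

lemma coarse_propagator_recurrence:
  assumes mu: "cmod mu < 1" and x: "x \<in> ell2"
  shows "coarse_propagator m nu lam mu x K - mu * coarse_propagator m nu lam mu x (K - 1) =
    lam ^ (m * nu) * (lam ^ m - mu) * x (K - int (Suc nu))"
  using conv_recip_coeff_right_inverse[of mu 0
      "\<lambda>K. lam ^ (m * nu) * (lam ^ m - mu) * x (K - int (Suc nu))" 0 K]
    mu ell2_scale(1)[OF ell2_delay[OF x]]
  by (simp add: coarse_propagator_def)

lemma coarse_propagator_A_op:
  assumes mu: "cmod mu < 1" and d: "d \<in> ell2"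
  shows "coarse_propagator m nu lam mu (\<lambda>K. d K - mu * d (K - 1)) =
    (\<lambda>K. lam ^ (m * nu) * (lam ^ m - mu) * d (K - int (Suc nu)))"
proof -
  define y where "y = (\<lambda>K. lam ^ (m * nu) * (lam ^ m - mu) * d (K - int (Suc nu)))"
  have y: "y \<in> ell2" unfolding y_def by (rule ell2_scale(1)[OF ell2_delay[OF d]])
  have "coarse_propagator m nu lam mu (\<lambda>K. d K - mu * d (K - 1)) =
      conv (recip_coeff mu 0 0) (\<lambda>K. y K - mu * y (K - 1) - 0 * y (K - int (Suc 0)))"
    unfolding coarse_propagator_def
    by (rule arg_cong[where f = "conv (recip_coeff mu 0 0)"]) (simp add: y_def fun_eq_iff algebra_simps)
  also have "\<dots> = y" using mu by (intro conv_recip_coeff_left_inverse y) simp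
  finally show ?thesis by (simp add: y_def)
qed

text \<open>With \<open>C = \<lambda>^(m \<nu>) (\<lambda>^m - \<mu>)\<close> and \<open>G\<close> the coarse propagator,
  \<open>z I - G = z (I - \<mu> L)^-1 (I - \<mu> L - (C / z) L^(\<nu> + 1))\<close>, and the hypothesis on \<open>z\<close> says exactly
  that \<open>\<bar>\<mu>\<bar> + \<bar>C / z\<bar> < 1\<close>. So the last factor is inverted by a convolution.\<close>

lemma coarse_propagator_resolvent_exists:
  assumes mu: "cmod mu < 1"
    and z: "cmod (lam ^ (m * nu) * (lam ^ m - mu)) < cmod z * (1 - cmod mu)"
  obtains H where "ell2_bounded_linear H"
    and "\<And>x. x \<in> ell2 \<Longrightarrow> H (\<lambda>k. z * x k - coarse_propagator m nu lam mu x k) = x"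
    and "\<And>x. x \<in> ell2 \<Longrightarrow> (\<lambda>k. z * H x k - coarse_propagator m nu lam mu (H x) k) = x"
proof -
  define C where "C = lam ^ (m * nu) * (lam ^ m - mu)"
  let ?G = "coarse_propagator m nu lam mu"
  let ?W = "conv (recip_coeff mu (C / z) nu)"
  have z0: "z \<noteq> 0"
    using z norm_ge_zero[of "lam ^ (m * nu) * (lam ^ m - mu)"] by (intro notI) (simp del: norm_ge_zero)
  have q: "cmod mu + cmod (C / z) < 1"
    using z z0 by (simp add: C_def norm_divide field_simps)
  note W = ell2_bounded_linear_conv[OF summable_norm_recip_coeff[OF q], of nu]
  note G = ell2_bounded_linear_coarse_propagator[OF mu, of m nu lam]
  define H where "H = (\<lambda>x k. 1 / z * (?W x k - mu * ?W x (k - 1)))"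
  show ?thesis
  proof
    show "ell2_bounded_linear H"
      unfolding H_def
      by (intro ell2_bounded_linear_scale ell2_bounded_linear_minus W
          ell2_bounded_linear_comp[OF ell2_bounded_linear_reindex[OF inj_minus_const] W])
  next
    fix x assume x: "x \<in> ell2"
    define y where "y = (\<lambda>k. z * x k - ?G x k)"
    have y: "y \<in> ell2"
      unfolding y_def by (intro ell2_diff ell2_scale x ell2_bounded_linearD(1)[OF G])
    have t: "(\<lambda>k. x k - mu * x (k - 1) - C / z * x (k - int (Suc nu))) \<in> ell2"
      by (intro ell2_diff ell2_scale ell2_delay x)
    have "(\<lambda>k. ?W y k - mu * ?W y (k - 1)) = ?W (\<lambda>k. y k - mu * y (k - 1))"
      using ell2_bounded_linear_diff[OF W y ell2_scale(1)[OF ell2_delay[OF y, of 1], of mu]]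
        ell2_bounded_linearD(3)[OF W ell2_delay[OF y, of 1], of mu] conv_delay[of _ y 1] by simp
    also have "(\<lambda>k. y k - mu * y (k - 1)) =
        (\<lambda>k. z * (x k - mu * x (k - 1) - C / z * x (k - int (Suc nu))))"
    proof
      fix k
      show "y k - mu * y (k - 1) = z * (x k - mu * x (k - 1) - C / z * x (k - int (Suc nu)))"
        using coarse_propagator_recurrence[OF mu x, of m nu lam k] z0
        unfolding C_def[symmetric] y_def by (simp add: algebra_simps)
    qed
    also have "?W \<dots> = (\<lambda>k. z * x k)"
      unfolding ell2_bounded_linearD(3)[OF W t] conv_recip_coeff_left_inverse[OF q x] ..
    finally show "H (\<lambda>k. z * x k - ?G x k) = x"
      using z0 by (simp add: H_def y_def fun_eq_iff)
  next
    fix x assume x: "x \<in> ell2"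
    define g where "g = ?W x"
    have g: "g \<in> ell2" unfolding g_def by (rule ell2_bounded_linearD(1)[OF W x])
    have d: "(\<lambda>k. g k - mu * g (k - 1)) \<in> ell2" by (intro ell2_diff ell2_scale ell2_delay g)
    have "?G (H x) = ?G (\<lambda>k. 1 / z * (g k - mu * g (k - 1)))" by (simp add: H_def g_def)
    also have "\<dots> = (\<lambda>k. 1 / z * (C * g (k - int (Suc nu))))"
      unfolding ell2_bounded_linearD(3)[OF G d] coarse_propagator_A_op[OF mu g] C_def ..
    finally have "?G (H x) = (\<lambda>k. 1 / z * (C * g (k - int (Suc nu))))" .
    then show "(\<lambda>k. z * H x k - ?G (H x) k) = x"
      using conv_recip_coeff_right_inverse[OF q x, of nu] z0
      by (simp add: H_def g_def fun_eq_iff)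
  qed
qed

text \<open>With \<open>V\<close> the interpolation and \<open>R\<close> the restriction to C-points, \<open>R V = I\<close> makes \<open>V R\<close> a projection.
  The error propagator \<open>V G R\<close> vanishes on its kernel and acts as \<open>G\<close> on its range, so the resolvent of
  \<open>G\<close> on the range and \<open>1 / z\<close> on the kernel combine to a resolvent of \<open>V G R\<close>.\<close>

lemma ell2_spectrum_E_op_bound:
  assumes m: "m \<ge> 1" and lam: "cmod lam < 1" and mu: "cmod mu < 1"
    and z: "z \<in> ell2_spectrum (E_op m nu lam mu)"
  shows "cmod z * (1 - cmod mu) \<le> cmod (lam ^ (m * nu) * (lam ^ m - mu))"
proof (rule ccontr)
  assume "\<not> ?thesis"
  then have z_large: "cmod (lam ^ (m * nu) * (lam ^ m - mu)) < cmod z * (1 - cmod mu)" by simp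
  then have z0: "z \<noteq> 0"
    using norm_ge_zero[of "lam ^ (m * nu) * (lam ^ m - mu)"] by (intro notI) (simp del: norm_ge_zero)
  let ?G = "coarse_propagator m nu lam mu" and ?E = "E_op m nu lam mu"
  let ?V = "prolong m lam" and ?R = "c_points m"
  obtain H where H: "ell2_bounded_linear H"
    and HL: "\<And>x. x \<in> ell2 \<Longrightarrow> H (\<lambda>k. z * x k - ?G x k) = x"
    and HR: "\<And>x. x \<in> ell2 \<Longrightarrow> (\<lambda>k. z * H x k - ?G (H x) k) = x"
    using coarse_propagator_resolvent_exists[OF mu z_large] by blast
  note V = ell2_bounded_linear_prolong[OF m lam] and R = ell2_bounded_linear_c_points[OF m]
  \<comment> \<open>\<open>1 / z\<close> on the kernel of the projection \<open>V R\<close>, the coarse resolvent on its range\<close>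
  define Q where "Q = (\<lambda>x k. 1 / z * (x k - ?V (?R x) k) + ?V (H (?R x)) k)"
  have Q: "ell2_bounded_linear Q"
    unfolding Q_def
    by (intro ell2_bounded_linear_add ell2_bounded_linear_scale ell2_bounded_linear_minus
        ell2_bounded_linear_id ell2_bounded_linear_comp[OF V R]
        ell2_bounded_linear_comp[OF V ell2_bounded_linear_comp[OF H R]])
  have "Q (\<lambda>k. z * x k - ?E x k) = x \<and> (\<lambda>k. z * Q x k - ?E (Q x) k) = x" if x: "x \<in> ell2" for x
  proof
    define u where "u = ?R x"
    have u: "u \<in> ell2" unfolding u_def by (rule ell2_bounded_linearD(1)[OF R x])
    have Ex: "?E x = ?V (?G u)" unfolding u_def by (rule E_op_factor[OF m mu x])
    have Rx: "?R (\<lambda>k. z * x k - ?V (?G u) k) = (\<lambda>K. z * u K - ?G u K)"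
      using c_points_prolong[OF m, of lam "?G u"] by (simp add: c_points_def u_def fun_eq_iff)
    show "Q (\<lambda>k. z * x k - ?E x k) = x"
      unfolding Q_def Ex Rx HL[OF u] prolong_diff prolong_scale
      using z0 by (simp add: fun_eq_iff field_simps)
    have "?R (Q x) = H u"
      using c_points_prolong[OF m, of lam] by (simp add: Q_def c_points_def u_def fun_eq_iff)
    then have E: "?E (Q x) = ?V (?G (H u))"
      using E_op_factor[OF m mu ell2_bounded_linearD(1)[OF Q x]] by simp
    have "?V u = (\<lambda>k. z * ?V (H u) k - ?V (?G (H u)) k)"
      using arg_cong[OF HR[OF u], of ?V] by (simp add: prolong_diff prolong_scale)
    then show "(\<lambda>k. z * Q x k - ?E (Q x) k) = x"
      unfolding E unfolding Q_def u_def[symmetric]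
      using z0 by (simp add: fun_eq_iff algebra_simps)
  qed
  then have "z \<notin> ell2_spectrum ?E" using Q by (auto simp: ell2_spectrum_def)
  with z show False by simp
qed

lemma ell2_finite_support:
  assumes S: "finite S" and M: "M \<ge> 0" and out: "\<And>k. k \<notin> S \<Longrightarrow> x k = 0"
    and inS: "\<And>k. k \<in> S \<Longrightarrow> cmod (x k) \<le> M"
  shows "x \<in> ell2" "ell2_norm x \<le> sqrt (real (card S)) * M"
proof -
  have "L2_set (\<lambda>k. cmod (x k)) F \<le> sqrt (real (card S)) * M" if F: "finite F" for F
  proof -
    have "(\<Sum>k\<in>F. (cmod (x k))\<^sup>2) = (\<Sum>k\<in>F \<inter> S. (cmod (x k))\<^sup>2)"
      using F out by (intro sum.mono_neutral_right) auto
    also have "\<dots> \<le> (\<Sum>k\<in>F \<inter> S. M\<^sup>2)" using inS by (intro sum_mono power_mono) auto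
    also have "\<dots> \<le> (\<Sum>k\<in>S. M\<^sup>2)" using S by (intro sum_mono2) auto
    finally have "L2_set (\<lambda>k. cmod (x k)) F \<le> sqrt (real (card S) * M\<^sup>2)"
      unfolding L2_set_def by (intro real_sqrt_le_mono) simp
    then show ?thesis using M by (simp add: real_sqrt_mult)
  qed
  from ell2_if_L2_set_le[OF this] show "x \<in> ell2" "ell2_norm x \<le> sqrt (real (card S)) * M" by auto
qed

text \<open>For every \<open>w\<close> on the unit circle the value at \<open>w\<close> of the symbol of the coarse propagator \<open>G\<close> lies in the
  spectrum: the mode \<open>w^(-k)\<close> would be an eigenvector if it were square summable. Cut off to \<open>N + 1\<close>
  entries and multiplied by \<open>I - \<mu> L\<close> (which spares an estimate for \<open>(I - \<mu> L)^-1\<close>), it gives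
  vectors of norm at least of order \<open>sqrt N\<close> on which \<open>z I - G\<close> leaves only boundary terms bounded
  independently of \<open>N\<close>. A bounded inverse of \<open>z I - V G R\<close> cannot exist, as the interpolation of these
  vectors does not decrease their norm.\<close>

lemma coarse_symbol_in_ell2_spectrum_E_op:
  fixes m nu :: nat and lam mu w :: complex
  assumes m: "m \<ge> 1" and lam: "cmod lam < 1" and mu: "cmod mu < 1" and w: "cmod w = 1"
  defines "C \<equiv> lam ^ (m * nu) * (lam ^ m - mu)"
  shows "C * w ^ Suc nu / (1 - mu * w) \<in> ell2_spectrum (E_op m nu lam mu)"
proof (rule ccontr)
  define z where "z = C * w ^ Suc nu / (1 - mu * w)"
  let ?G = "coarse_propagator m nu lam mu" and ?E = "E_op m nu lam mu" and ?V = "prolong m lam"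
  assume "C * w ^ Suc nu / (1 - mu * w) \<notin> ell2_spectrum ?E"
  then obtain Q where Q: "ell2_bounded_linear Q"
    and QL: "\<And>x. x \<in> ell2 \<Longrightarrow> Q (\<lambda>k. z * x k - ?E x k) = x"
    by (auto simp: ell2_spectrum_def z_def)
  obtain B where B: "B \<ge> 0" "\<And>x. x \<in> ell2 \<Longrightarrow> ell2_norm (Q x) \<le> B * ell2_norm x"
    using ell2_bounded_linear_bound[OF Q] by blast
  note V = ell2_bounded_linear_prolong[OF m lam]
  obtain D where D: "D \<ge> 0" "\<And>x. x \<in> ell2 \<Longrightarrow> ell2_norm (?V x) \<le> D * ell2_norm x"
    using ell2_bounded_linear_bound[OF V] by blast
  have w0: "w \<noteq> 0" using w by auto
  have ne: "1 - mu * w \<noteq> 0"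
    using power_neq_one_if_norm_less_one[of "mu * w" 1] mu w by (simp add: norm_mult)
  define M where "M = cmod z + cmod z * cmod mu + cmod C"
  have M: "M \<ge> 0" by (simp add: M_def)
  define p where "p = int (Suc nu)"
  define K where "K = B * (D * (sqrt (2 * real (Suc nu)) * M))"
  have bound: "sqrt (real N) * cmod (1 - mu * w) \<le> K" for N
  proof -
    define d where "d = (\<lambda>k. if 0 \<le> k \<and> k \<le> int N then w powi (- k) else 0)"
    define c where "c = (\<lambda>k. d k - mu * d (k - 1))"
    define u where "u = (\<lambda>k. z * c k - ?G c k)"
    have d_le: "cmod (d k) \<le> 1" for k by (simp add: d_def norm_power_int w)
    have d: "d \<in> ell2"
      by (rule ell2_finite_support(1)[of "{0..int N}" 1]) (auto simp: d_def norm_power_int w)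
    have c: "c \<in> ell2" unfolding c_def by (intro ell2_diff ell2_scale ell2_delay d)
    have u_eq: "u k = z * d k - z * mu * d (k - 1) - C * d (k - p)" for k
      unfolding u_def c_def coarse_propagator_A_op[OF mu d] C_def p_def by (simp add: algebra_simps)
    define S where "S = {0..<p} \<union> {int N<..int N + p}"
    have cardS: "real (card S) \<le> 2 * real (Suc nu)"
    proof -
      have "card S \<le> card {0..<p} + card {int N<..int N + p}" unfolding S_def by (rule card_Un_le)
      then show ?thesis by (simp add: p_def)
    qed
    \<comment> \<open>away from the two ends of the cut-off the factor \<open>z (1 - \<mu> w) - C w^(\<nu> + 1)\<close> vanishes by the choice of \<open>z\<close>\<close>
    have u_out: "u k = 0" if "k \<notin> S" for k
    proof (cases "p \<le> k \<and> k \<le> int N")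
      case True
      have "w powi (- (k - 1)) = w powi (- k) * w"
        using power_int_add[of w "- k" 1] w0 by simp
      moreover have "w powi (- (k - p)) = w powi (- k) * w ^ Suc nu"
        using power_int_add[of w "- k" p] w0 by (simp add: p_def power_int_of_nat del: power_Suc of_nat_Suc)
      ultimately have "u k = w powi (- k) * (z * (1 - mu * w) - C * w ^ Suc nu)"
        using True by (simp add: u_eq d_def p_def algebra_simps)
      also have "z * (1 - mu * w) = C * w ^ Suc nu" using ne by (simp add: z_def)
      finally show ?thesis by simp
    next
      case False
      then have "k < 0 \<or> k > int N + p" using that by (auto simp: S_def)
      then show ?thesis by (auto simp: u_eq d_def p_def)
    qed
    have u_le: "cmod (u k) \<le> M" for k
    proof -
      have "cmod (u k) \<le> cmod (z * d k) + cmod (z * mu * d (k - 1)) + cmod (C * d (k - p))"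
        unfolding u_eq by (intro order_trans[OF norm_triangle_ineq4] add_right_mono norm_triangle_ineq4)
      also have "\<dots> \<le> cmod z * 1 + cmod z * cmod mu * 1 + cmod C * 1"
        unfolding norm_mult by (intro add_mono mult_left_mono d_le) auto
      finally show ?thesis by (simp add: M_def)
    qed
    have u: "u \<in> ell2" "ell2_norm u \<le> sqrt (real (card S)) * M"
      using ell2_finite_support[of S M u] M u_out u_le by (auto simp: S_def)
    have "sqrt (real N) * cmod (1 - mu * w) = L2_set (\<lambda>k. cmod (c k)) {1..int N}"
    proof -
      have "cmod (c k) = cmod (1 - mu * w)" if "k \<in> {1..int N}" for k
      proof -
        have "w powi (- (k - 1)) = w powi (- k) * w"
          using power_int_add[of w "- k" 1] w0 by simp
        then have "c k = w powi (- k) * (1 - mu * w)"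
          using that by (simp add: c_def d_def algebra_simps)
        then show ?thesis by (simp add: norm_mult norm_power_int w)
      qed
      then have "L2_set (\<lambda>k. cmod (c k)) {1..int N} = L2_set (\<lambda>_. cmod (1 - mu * w)) {1..int N}"
        by (intro L2_set_cong) auto
      then show ?thesis by (simp add: L2_set_constant)
    qed
    also have "\<dots> \<le> ell2_norm c" by (rule ell2_L2_set_le[OF c]) simp
    also have "\<dots> \<le> ell2_norm (?V c)"
      using ell2_norm_c_points_le[OF m ell2_bounded_linearD(1)[OF V c]] c_points_prolong[OF m] by simp
    also have "?V c = Q (?V u)"
    proof -
      have Vc: "?V c \<in> ell2" by (rule ell2_bounded_linearD(1)[OF V c])
      have "?V u = (\<lambda>k. z * ?V c k - ?E (?V c) k)"
        unfolding E_op_factor[OF m mu Vc] c_points_prolong[OF m] u_def prolong_diff prolong_scale ..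
      then show ?thesis using QL[OF Vc] by simp
    qed
    also have "ell2_norm (Q (?V u)) \<le> B * ell2_norm (?V u)"
      by (rule B(2)[OF ell2_bounded_linearD(1)[OF V u(1)]])
    also have "\<dots> \<le> B * (D * ell2_norm u)" by (intro mult_left_mono D(2) u B)
    also have "\<dots> \<le> B * (D * (sqrt (real (card S)) * M))" by (intro mult_left_mono u B D)
    also have "\<dots> \<le> K"
      unfolding K_def using cardS
      by (intro mult_left_mono mult_right_mono B D M real_sqrt_le_mono)
    finally show ?thesis .
  qed
  define \<delta> where "\<delta> = cmod (1 - mu * w)"
  have \<delta>: "\<delta> > 0" using ne by (simp add: \<delta>_def)
  obtain N :: nat where N: "real N > (K / \<delta>)\<^sup>2" using reals_Archimedean2 by blast
  then have "sqrt (real N) > \<bar>K / \<delta>\<bar>" by (metis real_sqrt_abs real_sqrt_less_mono)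
  then have "sqrt (real N) * \<delta> > K" using \<delta> by (simp add: field_simps)
  with bound[of N] show False by (simp add: \<delta>_def)
qed

text \<open>The upper bound for the spectrum is attained by the symbol of the coarse propagator
  at \<open>w = cis (- Arg \<mu>)\<close>.\<close>

lemma ell2_spectral_radius_E_op:
  assumes m: "m \<ge> 1" and lam: "cmod lam < 1" and mu: "cmod mu < 1"
  shows "ell2_spectral_radius (E_op m nu lam mu) =
    cmod lam ^ (m * nu) * (cmod (lam ^ m - mu) / (1 - cmod mu))"
proof -
  define C where "C = lam ^ (m * nu) * (lam ^ m - mu)"
  have C: "cmod lam ^ (m * nu) * (cmod (lam ^ m - mu) / (1 - cmod mu)) = cmod C / (1 - cmod mu)"
    by (simp add: C_def norm_mult norm_power)
  \<comment> \<open>on the unit circle \<open>\<bar>1 - \<mu> w\<bar>\<close> is smallest where \<open>\<mu> w\<close> is a nonnegative real\<close>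
  obtain w where w: "cmod w = 1" "mu * w = of_real (cmod mu)"
  proof
    show "cmod (cis (- Arg mu)) = 1" by simp
    have "mu = of_real (cmod mu) * cis (Arg mu)" by (metis rcis_cmod_Arg rcis_def)
    then have "mu * cis (- Arg mu) = of_real (cmod mu) * (cis (Arg mu) * cis (- Arg mu))"
      by (metis mult.assoc)
    then show "mu * cis (- Arg mu) = of_real (cmod mu)" by (simp add: cis_mult)
  qed
  have "1 - mu * w = of_real (1 - cmod mu)" by (simp add: w(2))
  then have "cmod (1 - mu * w) = \<bar>1 - cmod mu\<bar>" by (simp only: norm_of_real)
  then have "cmod (1 - mu * w) = 1 - cmod mu" using mu by simp
  then have "cmod (C * w ^ Suc nu / (1 - mu * w)) = cmod C / (1 - cmod mu)"
    by (simp add: norm_mult norm_divide norm_power w del: power_Suc)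
  moreover note coarse_symbol_in_ell2_spectrum_E_op[OF m lam mu w(1), of nu]
  ultimately have "cmod C / (1 - cmod mu) \<in> cmod ` ell2_spectrum (E_op m nu lam mu)"
    unfolding C_def by (metis imageI)
  moreover have "r \<le> cmod C / (1 - cmod mu)" if r: "r \<in> cmod ` ell2_spectrum (E_op m nu lam mu)" for r
  proof -
    obtain z where z: "z \<in> ell2_spectrum (E_op m nu lam mu)" "r = cmod z" using r by auto
    have "cmod z * (1 - cmod mu) \<le> cmod C"
      using ell2_spectrum_E_op_bound[OF m lam mu z(1)] by (simp only: C_def)
    then show ?thesis using mu by (simp add: z(2) pos_le_divide_eq)
  qed
  ultimately show ?thesis
    unfolding ell2_spectral_radius_def C by (intro cSup_eq_maximum)
qed

section \<open>Sums over the harmonics\<close>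

lemma sum_cis_powers:
  fixes m j :: nat
  assumes "j < m"
  shows "(\<Sum>\<alpha><m. cis (- (\<theta> + 2 * pi * real \<alpha> / real m)) ^ j) = (if j = 0 then of_nat m else 0)"
proof (cases "j = 0")
  case False
  define w where "w = cis (- (2 * pi * real j / real m))"
  have "cis (- (\<theta> + 2 * pi * real \<alpha> / real m)) ^ j = cis (- (real j * \<theta>)) * w ^ \<alpha>" for \<alpha>
    unfolding w_def Complex.DeMoivre cis_mult by (rule arg_cong[where f = cis]) (simp add: algebra_simps)
  then have "(\<Sum>\<alpha><m. cis (- (\<theta> + 2 * pi * real \<alpha> / real m)) ^ j) =
      cis (- (real j * \<theta>)) * (\<Sum>\<alpha><m. w ^ \<alpha>)"
    by (simp add: sum_distrib_left)
  moreover have "w ^ m = 1"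
  proof -
    have "w ^ m = inverse (cis (2 * pi * real j))"
      unfolding w_def Complex.DeMoivre cis_inverse
      by (rule arg_cong[where f = cis]) (use assms in simp)
    also have "cis (2 * pi * real j) = 1" by (rule cis_multiple_2pi) simp
    finally show ?thesis by simp
  qed
  moreover have "w \<noteq> 1"
  proof
    assume "w = 1"
    then have "cos (2 * pi * real j / real m) = 1" by (simp add: w_def complex_eq_iff)
    then obtain n :: int where "2 * pi * real j / real m = real_of_int n * 2 * pi"
      by (auto simp: cos_one_2pi_int)
    then have "real j = real_of_int n * real m"
      using assms by (simp add: field_simps)
    then have "int j = n * int m" by (metis of_int_eq_iff of_int_mult of_int_of_nat_eq)
    then have "int m dvd int j" by simp
    then have "m dvd j" by simp
    with assms False show False by (auto dest: dvd_imp_le)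
  qed
  then have "(\<Sum>\<alpha><m. w ^ \<alpha>) = 0" using \<open>w ^ m = 1\<close> by (simp add: sum_gp_strict)
  ultimately show ?thesis using False by simp
qed simp

text \<open>The \<open>m\<close> harmonics share their \<open>m\<close>th power, so \<open>1 / (1 - x) = (\<Sum>j<m. x^j) / (1 - x^m)\<close> puts all terms
  over a common denominator; by orthogonality of the harmonics only \<open>j = 0\<close> survives. This is the
  identity behind the normalisation of \<open>SF_hat\<close>, which it makes a projection.\<close>

lemma sum_resolvent_harmonics:
  fixes m :: nat and lam :: complex
  assumes m: "m \<ge> 1" and lam: "cmod lam < 1"
  shows "(\<Sum>\<alpha><m. 1 / (1 - lam * cis (- (\<theta> + 2 * pi * real \<alpha> / real m)))) =
         of_nat m / (1 - (lam * cis (- \<theta>)) ^ m)"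
proof -
  define w where "w = (\<lambda>\<alpha>::nat. cis (- (\<theta> + 2 * pi * real \<alpha> / real m)))"
  have wm: "w \<alpha> ^ m = cis (- \<theta>) ^ m" for \<alpha>
  proof -
    have "w \<alpha> ^ m = cis (- (real m * \<theta>)) * inverse (cis (2 * pi * real \<alpha>))"
      unfolding w_def Complex.DeMoivre cis_mult cis_inverse
      by (rule arg_cong[where f = cis]) (use m in \<open>simp add: field_simps\<close>)
    also have "cis (2 * pi * real \<alpha>) = 1" by (rule cis_multiple_2pi) simp
    finally show ?thesis by (simp add: Complex.DeMoivre)
  qed
  have ne: "lam * w \<alpha> \<noteq> 1" for \<alpha>
    using power_neq_one_if_norm_less_one[of "lam * w \<alpha>" 1] lam by (simp add: norm_mult w_def)
  define t where "t = (lam * cis (- \<theta>)) ^ m"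
  have t: "t \<noteq> 1"
    unfolding t_def using m lam by (intro power_neq_one_if_norm_less_one) (simp_all add: norm_mult)
  have "1 / (1 - lam * w \<alpha>) = (\<Sum>j<m. lam ^ j * w \<alpha> ^ j) / (1 - t)" for \<alpha>
  proof -
    have "(\<Sum>j<m. lam ^ j * w \<alpha> ^ j) = (\<Sum>j<m. (lam * w \<alpha>) ^ j)"
      by (simp add: power_mult_distrib)
    also have "\<dots> = (1 - (lam * w \<alpha>) ^ m) / (1 - lam * w \<alpha>)"
      using ne[of \<alpha>] by (simp add: sum_gp_strict)
    also have "(lam * w \<alpha>) ^ m = t" unfolding t_def power_mult_distrib wm ..
    finally show ?thesis using t by simp
  qed
  then have "(\<Sum>\<alpha><m. 1 / (1 - lam * w \<alpha>)) =
      (\<Sum>\<alpha><m. \<Sum>j<m. lam ^ j * w \<alpha> ^ j) / (1 - t)"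
    by (simp add: sum_divide_distrib)
  also have "(\<Sum>\<alpha><m. \<Sum>j<m. lam ^ j * w \<alpha> ^ j) = (\<Sum>j<m. lam ^ j * (\<Sum>\<alpha><m. w \<alpha> ^ j))"
    by (subst sum.swap) (simp add: sum_distrib_left)
  also have "\<dots> = (\<Sum>j<m. if j = 0 then of_nat m else 0)"
  proof (rule sum.cong)
    fix j assume "j \<in> {..<m}"
    then have "(\<Sum>\<alpha><m. w \<alpha> ^ j) = (if j = 0 then of_nat m else 0)"
      unfolding w_def by (intro sum_cis_powers) simp
    then show "lam ^ j * (\<Sum>\<alpha><m. w \<alpha> ^ j) = (if j = 0 then of_nat m else 0)" by simp
  qed simp
  also have "\<dots> = of_nat m" using m by simp
  finally show ?thesis by (simp add: w_def t_def)
qed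

section \<open>The Fourier symbol as a matrix of rank one\<close>

definition outer :: "nat \<Rightarrow> (nat \<Rightarrow> complex) \<Rightarrow> (nat \<Rightarrow> complex) \<Rightarrow> complex Matrix.mat" where
  "outer m f g = Matrix.mat m m (\<lambda>(i, j). f i * g j)"

lemma outer_carrier [simp]: "outer m f g \<in> carrier_mat m m"
  by (simp add: outer_def)

lemma dim_outer [simp]: "dim_row (outer m f g) = m" "dim_col (outer m f g) = m"
  by (simp_all add: outer_def)

lemma outer_mult:
  "outer m f g * outer m f' g' = (\<Sum>i<m. g i * f' i) \<cdot>\<^sub>m outer m f g'"
  by (rule eq_matI)
     (auto simp: outer_def scalar_prod_def sum_distrib_left sum_distrib_right mult.assoc
           lessThan_atLeast0 intro!: sum.cong)

lemma smult_smult_mat: "a \<cdot>\<^sub>m (b \<cdot>\<^sub>m A) = (a * b :: complex) \<cdot>\<^sub>m A"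
  by (auto intro!: eq_matI)

lemma outer_pow_mult:
  "outer m f g ^\<^sub>m n * outer m f h = (\<Sum>i<m. g i * f i) ^ n \<cdot>\<^sub>m outer m f h"
proof (induction n)
  case 0
  then show ?case by (auto simp: outer_def intro!: eq_matI)
next
  case (Suc n)
  have "outer m f g ^\<^sub>m Suc n * outer m f h = outer m f g ^\<^sub>m n * (outer m f g * outer m f h)"
    by (simp add: assoc_mult_mat[of _ m m _ m _ m] pow_carrier_mat)
  also have "\<dots> = (\<Sum>i<m. g i * f i) \<cdot>\<^sub>m (outer m f g ^\<^sub>m n * outer m f h)"
    by (simp add: outer_mult mult_smult_distrib[of _ m m _ m] pow_carrier_mat)
  finally show ?case by (simp add: Suc smult_smult_mat mult.commute)
qed

text \<open>Every eigenvalue is \<open>0\<close> or the trace \<open>s\<close>, and a nonzero \<open>s\<close> has the eigenvector \<open>f\<close>. For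
  \<open>s = 0\<close> the value \<open>0\<close> is attained because the spectrum is not empty.\<close>

lemma spectral_radius_outer:
  assumes m: "m \<ge> 1"
  shows "spectral_radius (outer m f g) = cmod (\<Sum>i<m. g i * f i)"
proof -
  let ?s = "\<Sum>i<m. g i * f i"
  have mv: "outer m f g *\<^sub>v v = (\<Sum>i<m. g i * vec_index v i) \<cdot>\<^sub>v Matrix.vec m f" if "v \<in> carrier_vec m" for v
    using that
    by (intro eq_vecI)
       (auto simp: outer_def scalar_prod_def sum_distrib_left sum_distrib_right lessThan_atLeast0
          algebra_simps intro!: sum.cong)
  have ev: "k = 0 \<or> k = ?s" if k: "eigenvalue (outer m f g) k" for k
  proof -
    obtain v where v: "v \<in> carrier_vec m" "v \<noteq> 0\<^sub>v m" "outer m f g *\<^sub>v v = k \<cdot>\<^sub>v v"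
      using k by (auto simp: eigenvalue_def eigenvector_def)
    define t where "t = (\<Sum>i<m. g i * vec_index v i)"
    have "t \<cdot>\<^sub>v Matrix.vec m f = k \<cdot>\<^sub>v v" using mv[OF v(1)] v(3) by (simp add: t_def)
    then have kv: "k * vec_index v i = t * f i" if "i < m" for i
      using that v(1) by (metis carrier_vecD index_smult_vec(1) index_vec dim_vec)
    have "k * t = (\<Sum>i<m. g i * (k * vec_index v i))" by (simp add: t_def sum_distrib_left algebra_simps)
    also have "\<dots> = t * ?s" by (simp add: kv sum_distrib_left algebra_simps)
    finally have "t = 0 \<or> k = ?s" by (auto simp: mult.commute)
    moreover have "k = 0" if "t = 0"
    proof -
      obtain i where "i < m" "vec_index v i \<noteq> 0" using v(1,2) by (metis carrier_vecD eq_vecI index_zero_vec)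
      then show ?thesis using kv[of i] that by simp
    qed
    ultimately show ?thesis by blast
  qed
  have m0: "m > 0" using m by simp
  note sr = spectral_radius_mem_max[OF outer_carrier[of m f g] m0]
  have le: "spectral_radius (outer m f g) \<in> {0, cmod ?s}"
    using sr(1) by (auto simp: spectrum_def dest: ev)
  show ?thesis
  proof (cases "?s = 0")
    case False
    have "Matrix.vec m f \<noteq> 0\<^sub>v m"
    proof
      assume "Matrix.vec m f = 0\<^sub>v m"
      then have "f i = 0" if "i < m" for i using that by (metis index_vec index_zero_vec(1))
      then show False using False by simp
    qed
    moreover have "outer m f g *\<^sub>v Matrix.vec m f = ?s \<cdot>\<^sub>v Matrix.vec m f"
      using mv[of "Matrix.vec m f"] by simp
    ultimately have "eigenvalue (outer m f g) ?s"
      by (auto simp: eigenvalue_def eigenvector_def outer_def intro!: exI[of _ "Matrix.vec m f"])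
    then have "cmod ?s \<le> spectral_radius (outer m f g)"
      by (intro sr(2)) (auto simp: spectrum_def)
    then show ?thesis using le by auto
  qed (use le in auto)
qed

lemma mat_inverse_mat_diag:
  fixes d :: "nat \<Rightarrow> complex"
  assumes "\<And>i. i < m \<Longrightarrow> d i \<noteq> 0"
  shows "mat_inverse (mat_diag m d) = Some (mat_diag m (\<lambda>i. 1 / d i))"
proof -
  let ?D = "mat_diag m d" and ?I = "mat_diag m (\<lambda>i. 1 / d i)"
  have one: "?D * ?I = 1\<^sub>m m" "?I * ?D = 1\<^sub>m m"
    unfolding mat_diag_diag using assms by (auto simp: mat_diag_def intro!: eq_matI)
  then have "?D \<in> Units (ring_mat TYPE(complex) m undefined)"
    by (auto simp: Units_def ring_mat_simps intro!: bexI[of _ ?I])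
  then obtain B where B: "mat_inverse ?D = Some B"
    using mat_inverse(1)[OF mat_diag_dim[of m d], of undefined] by (cases "mat_inverse ?D") auto
  then have inv: "B * ?D = 1\<^sub>m m" "B \<in> carrier_mat m m"
    using mat_inverse(2)[OF mat_diag_dim B] by auto
  have "B = B * (?D * ?I)" using inv(2) by (simp only: one right_mult_one_mat)
  also have "\<dots> = (B * ?D) * ?I"
    by (rule assoc_mult_mat[symmetric, OF inv(2) mat_diag_dim mat_diag_dim])
  also have "\<dots> = ?I" unfolding inv(1) by (rule left_mult_one_mat[OF mat_diag_dim])
  finally have "B = ?I" .
  then show ?thesis using B by simp
qed

text \<open>Since \<open>SF_hat\<close> is the rank-one projection with column \<open>a\<close> and row of ones, the symbol is a scalar
  multiple of it. The scalar only involves \<open>\<Sum>a = 1\<close> and \<open>\<Sum>d a = 1 - t\<close>, where \<open>d\<close> is the diagonal of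
  \<open>A0_hat\<close>: a relaxation sweep contributes \<open>t\<close>, the coarse-grid correction \<open>1 - (1 - t) / A1\<close>.\<close>

lemma E_hat_rank_one:
  fixes m nu :: nat and lam mu :: complex and \<theta> :: real
  assumes m: "m \<ge> 1" and lam: "cmod lam < 1" and mu: "cmod mu < 1"
  defines "t \<equiv> (lam * cis (- \<theta>)) ^ m"
  defines "a \<equiv> \<lambda>\<alpha>. (1 - t) / of_nat m / (1 - lam * cis (- (\<theta> + 2 * pi * real \<alpha> / real m)))"
  shows "(\<Sum>\<alpha><m. a \<alpha>) = 1"
    and "E_hat m nu lam mu \<theta> =
      (t ^ nu * (1 - (1 - t) / A1_hat mu (real m * \<theta>))) \<cdot>\<^sub>m outer m a (\<lambda>_. 1)"
proof -
  define d where "d = (\<lambda>\<alpha>. 1 - lam * cis (- (\<theta> + 2 * pi * real \<alpha> / real m)))"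
  define A1 where "A1 = A1_hat mu (real m * \<theta>)"
  have t: "t \<noteq> 1"
    unfolding t_def using m lam by (intro power_neq_one_if_norm_less_one) (simp_all add: norm_mult)
  have d: "d \<alpha> \<noteq> 0" for \<alpha>
    using power_neq_one_if_norm_less_one[of "lam * cis (- (\<theta> + 2 * pi * real \<alpha> / real m))" 1] lam
    by (simp add: norm_mult d_def)
  have a: "a = (\<lambda>\<alpha>. (1 - t) / of_nat m / d \<alpha>)" by (simp add: a_def d_def)
  have "(\<Sum>\<alpha><m. a \<alpha>) = (1 - t) / of_nat m * (\<Sum>\<alpha><m. 1 / d \<alpha>)"
    by (simp add: a sum_distrib_left)
  also have "(\<Sum>\<alpha><m. 1 / d \<alpha>) = of_nat m / (1 - t)"
    unfolding d_def t_def by (rule sum_resolvent_harmonics[OF m lam])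
  finally show sum_a: "(\<Sum>\<alpha><m. a \<alpha>) = 1" using t m by simp
  have sum_da: "(\<Sum>\<alpha><m. d \<alpha> * a \<alpha>) = 1 - t"
    using d m by (simp add: a)
  have A0: "A0_hat m lam \<theta> = mat_diag m d" by (simp add: A0_hat_def d_def)
  have ones: "ones m * transpose_mat (ones m) = outer m (\<lambda>_. 1) (\<lambda>_. 1)"
    by (rule eq_matI) (auto simp: ones_def outer_def scalar_prod_def)
  have SF: "SF_hat m lam \<theta> = outer m a (\<lambda>_. 1)"
    unfolding SF_hat_def A0 ones mat_inverse_mat_diag[OF d] option.sel
    by (subst mat_diag_mult_left[of _ m m]) (auto simp: outer_def a t_def intro!: eq_matI)
  have SCF: "SCF_hat m lam \<theta> = outer m a (\<lambda>\<alpha>. 1 - d \<alpha>)"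
  proof -
    have "1\<^sub>m m - A0_hat m lam \<theta> = mat_diag m (\<lambda>\<alpha>. 1 - d \<alpha>)"
      by (auto simp: A0 mat_diag_def intro!: eq_matI)
    then show ?thesis unfolding SCF_hat_def SF
      by (simp only:, subst mat_diag_mult_right[of _ m m]) (auto simp: outer_def intro!: eq_matI)
  qed
  have coarse: "P_hat m * (inverse A1 \<cdot>\<^sub>m transpose_mat (P_hat m)) =
      outer m (\<lambda>_. 1 / of_nat m / A1) (\<lambda>_. 1)"
  proof -
    have "complex_of_real (1 / sqrt (real m)) * complex_of_real (1 / sqrt (real m)) = 1 / of_nat m"
      by (simp flip: of_real_mult)
    then show ?thesis
      by (auto simp: P_hat_def ones_def outer_def scalar_prod_def field_simps intro!: eq_matI)
  qed
  have SFM: "SF_hat m lam \<theta> *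
     (1\<^sub>m m - P_hat m * (inverse A1 \<cdot>\<^sub>m transpose_mat (P_hat m)) * A0_hat m lam \<theta>) =
     outer m a (\<lambda>\<alpha>. 1 - d \<alpha> / A1)"
  proof -
    have cA: "outer m (\<lambda>_. 1 / of_nat m / A1) (\<lambda>_. 1) * mat_diag m d = outer m (\<lambda>_. 1 / of_nat m / A1) d"
      by (subst mat_diag_mult_right[of _ m m]) (auto simp: outer_def intro!: eq_matI)
    have "outer m a (\<lambda>_. 1) * (1\<^sub>m m - outer m (\<lambda>_. 1 / of_nat m / A1) d) =
       outer m a (\<lambda>_. 1) - outer m a (\<lambda>_. 1) * outer m (\<lambda>_. 1 / of_nat m / A1) d"
      by (subst mult_minus_distrib_mat[of _ m m _ m]) (auto simp: right_mult_one_mat[of _ m m])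
    also have "\<dots> = outer m a (\<lambda>\<alpha>. 1 - d \<alpha> / A1)"
      using m by (auto simp: outer_mult) (auto simp: outer_def algebra_simps intro!: eq_matI)
    finally show ?thesis by (simp only: SF coarse A0 cA)
  qed
  have "E_hat m nu lam mu \<theta> =
      outer m a (\<lambda>\<alpha>. 1 - d \<alpha> / A1) * (outer m a (\<lambda>\<alpha>. 1 - d \<alpha>) ^\<^sub>m nu * outer m a (\<lambda>_. 1))"
    unfolding E_hat_def A1_def[symmetric] SFM SCF
    by (simp add: SF assoc_mult_mat[of _ m m _ m _ m] pow_carrier_mat)
  also have "\<dots> = ((\<Sum>\<alpha><m. (1 - d \<alpha>) * a \<alpha>) ^ nu * (\<Sum>\<alpha><m. (1 - d \<alpha> / A1) * a \<alpha>)) \<cdot>\<^sub>m outer m a (\<lambda>_. 1)"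
    by (simp add: outer_pow_mult mult_smult_distrib[of _ m m _ m] outer_mult smult_smult_mat)
  also have "(\<Sum>\<alpha><m. (1 - d \<alpha>) * a \<alpha>) = t"
    using sum_a sum_da by (simp add: left_diff_distrib sum_subtractf)
  also have "(\<Sum>\<alpha><m. (1 - d \<alpha> / A1) * a \<alpha>) = 1 - (1 - t) / A1"
    using sum_a sum_da by (simp add: left_diff_distrib sum_subtractf flip: sum_divide_distrib)
  finally show "E_hat m nu lam mu \<theta> =
      (t ^ nu * (1 - (1 - t) / A1_hat mu (real m * \<theta>))) \<cdot>\<^sub>m outer m a (\<lambda>_. 1)"
    by (simp add: A1_def)
qed

text \<open>The scalar factor becomes the stated quotient after multiplying numerator and denominator by
  \<open>cis (m \<theta>)\<close>, which has modulus one.\<close>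

lemma spectral_radius_E_hat:
  fixes m nu :: nat and lam mu :: complex and \<theta> :: real
  assumes m: "m \<ge> 1" and lam: "cmod lam < 1" and mu: "cmod mu < 1"
  shows "spectral_radius (E_hat m nu lam mu \<theta>) =
    cmod lam ^ (m * nu) * (cmod (lam ^ m - mu) / cmod (cis (real m * \<theta>) - mu))"
proof -
  define t where "t = (lam * cis (- \<theta>)) ^ m"
  define a where "a = (\<lambda>\<alpha>. (1 - t) / of_nat m / (1 - lam * cis (- (\<theta> + 2 * pi * real \<alpha> / real m))))"
  define z where "z = cis (real m * \<theta>)"
  define s where "s = t ^ nu * (1 - (1 - t) / A1_hat mu (real m * \<theta>))"
  have "E_hat m nu lam mu \<theta> = s \<cdot>\<^sub>m outer m a (\<lambda>_. 1)"
    using E_hat_rank_one(2)[OF m lam mu] by (simp add: s_def a_def t_def)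
  also have "\<dots> = outer m (\<lambda>\<alpha>. s * a \<alpha>) (\<lambda>_. 1)"
    by (auto simp: outer_def intro!: eq_matI)
  finally have "spectral_radius (E_hat m nu lam mu \<theta>) = cmod (s * (\<Sum>\<alpha><m. a \<alpha>))"
    by (simp add: spectral_radius_outer[OF m] sum_distrib_left)
  also have "(\<Sum>\<alpha><m. a \<alpha>) = 1"
    using E_hat_rank_one(1)[OF m lam mu] by (simp add: a_def t_def)
  also have "s = t ^ nu * ((lam ^ m - mu) / (z - mu))"
  proof -
    have z: "z \<noteq> 0" "cmod z = 1" by (simp_all add: z_def)
    have zmu: "z \<noteq> mu" using z mu by auto
    have t: "t = lam ^ m / z"
      by (simp add: t_def z_def power_mult_distrib Complex.DeMoivre cis_inverse divide_inverse)
    have A1: "A1_hat mu (real m * \<theta>) = (z - mu) / z"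
      using z by (simp add: A1_hat_def z_def cis_inverse divide_inverse left_diff_distrib cis_mult)
    have "1 - (1 - t) / A1_hat mu (real m * \<theta>) = (lam ^ m - mu) / (z - mu)"
      unfolding t A1 using z zmu by (simp add: field_simps)
    then show ?thesis by (simp add: s_def)
  qed
  also have "cmod (t ^ nu * ((lam ^ m - mu) / (z - mu)) * 1) =
      cmod lam ^ (m * nu) * (cmod (lam ^ m - mu) / cmod (z - mu))"
    by (simp add: t_def norm_mult norm_divide norm_power power_mult)
  finally show ?thesis by (simp add: z_def)
qed

section \<open>Spectral radius of symbol and operator\<close>

theorem corollary2:
  fixes m nu :: nat and lam mu :: complex
  assumes "m \<ge> 1" and "cmod lam < 1" and "cmod mu < 1"
  shows
    "(\<forall>\<theta>\<in>Theta_low m.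
        spectral_radius (E_hat m nu lam mu \<theta>) =
          cmod lam ^ (m * nu) * (cmod (lam ^ m - mu) / cmod (cis (real m * \<theta>) - mu))) \<and>
     ell2_spectral_radius (E_op m nu lam mu) =
       (SUP \<theta>\<in>Theta_low m. spectral_radius (E_hat m nu lam mu \<theta>)) \<and>
     (\<forall>\<phi>\<in>{-pi..<pi}. is_Arg mu \<phi> \<longrightarrow>
        (SUP \<theta>\<in>Theta_low m. spectral_radius (E_hat m nu lam mu \<theta>)) =
          spectral_radius (E_hat m nu lam mu (\<phi> / real m)) \<and>
        spectral_radius (E_hat m nu lam mu (\<phi> / real m)) =
          cmod lam ^ (m * nu) * (cmod (lam ^ m - mu) / (1 - cmod mu)))"
proof -
  define S where "S = (\<lambda>\<theta>. spectral_radius (E_hat m nu lam mu \<theta>))"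
  define C where "C = cmod lam ^ (m * nu) * cmod (lam ^ m - mu)"
  have S: "S \<theta> = C / cmod (cis (real m * \<theta>) - mu)" for \<theta>
    by (simp add: S_def C_def spectral_radius_E_hat[OF assms])
  have S_le: "S \<theta> \<le> C / (1 - cmod mu)" for \<theta>
    unfolding S
  proof (rule divide_left_mono)
    show "1 - cmod mu \<le> cmod (cis (real m * \<theta>) - mu)"
      using norm_triangle_ineq2[of "cis (real m * \<theta>)" mu] by simp
    then show "0 < cmod (cis (real m * \<theta>) - mu) * (1 - cmod mu)"
      using assms(3) by (intro mult_pos_pos) auto
  qed (simp add: C_def)
  have S_max: "S (\<phi> / real m) = C / (1 - cmod mu)" if "is_Arg mu \<phi>" for \<phi>
  proof -
    have "mu = of_real (cmod mu) * cis \<phi>"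
      using that by (simp add: is_Arg_def cis_conv_exp)
    then have "cis \<phi> - mu = of_real (1 - cmod mu) * cis \<phi>"
      by (simp add: algebra_simps)
    then have "cmod (cis \<phi> - mu) = 1 - cmod mu"
      using assms(3) by (simp add: norm_mult del: of_real_diff)
    then show ?thesis using assms(1) by (simp add: S)
  qed
  have in_Theta: "\<phi> / real m \<in> Theta_low m" if "\<phi> \<in> {- pi..<pi}" for \<phi>
    using that assms(1) by (simp add: Theta_low_def field_simps)
  \<comment> \<open>\<open>Arg\<close> takes values in \<open>{-pi<..pi}\<close>, so the value \<open>pi\<close> has to be moved to \<open>-pi\<close>\<close>
  obtain \<phi>0 where \<phi>0: "\<phi>0 \<in> {- pi..<pi}" "is_Arg mu \<phi>0"
  proof (cases "Arg mu = pi")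
    case True
    have "is_Arg mu (Arg mu)" by (metis is_Arg_def cis_conv_exp rcis_cmod_Arg rcis_def)
    then have "is_Arg mu (- pi)" using is_Arg_2pi_iff[of mu "- pi" 1] True by simp
    then show ?thesis by (intro that[of "- pi"]) auto
  next
    case False
    have "is_Arg mu (Arg mu)" by (metis is_Arg_def cis_conv_exp rcis_cmod_Arg rcis_def)
    then show ?thesis using False Arg_bounded[of mu] by (intro that[of "Arg mu"]) auto
  qed
  have SUP: "(SUP \<theta>\<in>Theta_low m. S \<theta>) = C / (1 - cmod mu)"
    by (rule cSup_eq_maximum) (use S_max[OF \<phi>0(2)] in_Theta[OF \<phi>0(1)] S_le in \<open>auto intro: rev_image_eqI\<close>)
  show ?thesis
  proof (intro conjI ballI impI)
    show "ell2_spectral_radius (E_op m nu lam mu) =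
        (SUP \<theta>\<in>Theta_low m. spectral_radius (E_hat m nu lam mu \<theta>))"
      using SUP by (simp add: ell2_spectral_radius_E_op[OF assms] S_def C_def)
  next
    fix \<phi> assume "is_Arg mu \<phi>"
    then have max: "S (\<phi> / real m) = C / (1 - cmod mu)" by (rule S_max)
    then show "(SUP \<theta>\<in>Theta_low m. spectral_radius (E_hat m nu lam mu \<theta>)) =
        spectral_radius (E_hat m nu lam mu (\<phi> / real m))"
      using SUP by (simp add: S_def)
    show "spectral_radius (E_hat m nu lam mu (\<phi> / real m)) =
        cmod lam ^ (m * nu) * (cmod (lam ^ m - mu) / (1 - cmod mu))"
      using max by (simp add: S_def C_def)
  qed (rule spectral_radius_E_hat[OF assms])
qed

end
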